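(* Fix an equation $(f,q,w)$ as in the context with $\prod_{i=0}^{N-1}(1/f_i)>0$. Let $\gamma\in(-\pi,0)\cup(0,\pi)$ and $K=(k_{ij})\in SL(2,\mathbb R)$ with $k_{11}-f_0k_{12}\neq0$. Let $\mathbf V_K=\begin{pmatrix}k_{21}&k_{22}&0&0\\0&0&0&1\end{pmatrix}$. For $M\in\{K,-K\}$ with entries $m_{ij}$, write $\lambda_j(M)$, $\lambda_j(-M)$, $\lambda_j(e^{i\gamma}M)$, $\lambda_j(\mathbf V_K)$ for the eigenvalues with boundary conditions $[M|-I]$, $[-M|-I]$, $[e^{i\gamma}M|-I]$, $\mathbf V_K$; put $m_j=\min\{\lambda_j(M),\lambda_j(-M)\}$, $M_j=\max\{\lambda_j(M),\lambda_j(-M)\}$; and say $P(M)$ holds if for every $0\le j\le N-1$: $\lambda_j(M)<\lambda_j(e^{i\gamma}M)<\lambda_j(-M)$ for $j$ even and $\lambda_j(-M)<\lambda_j(e^{i\gamma}M)<\lambda_j(M)$ for $j$ odd. Then for each $M\in\{K,-K\}$: (i) if $m_{11}-f_0m_{12}>0$ and $f_0m_{22}-m_{21}>0$: $P(M)$ holds, $\lambda_j(\mathbf V_K)\le m_j$ for $0\le j\le N-1$, and $M_j\le\lambda_{j+1}(\mathbf V_K)$ for $0\le j\le N-2$; (ii) if $m_{11}-f_0m_{12}>0$ and $f_0m_{22}-m_{21}<0$: $P(M)$ holds, $M_j\le\lambda_j(\mathbf V_K)\le m_{j+1}$ for $0\le j\le N-2$, and $M_{N-1}\le\lambda_{N-1}(\mathbf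 V_K)$; (iii) if $m_{11}-f_0m_{12}>0$ and $f_0m_{22}-m_{21}=0$: $P(M)$ holds and $M_j\le\lambda_j(\mathbf V_K)\le m_{j+1}$ for $0\le j\le N-2$.
   Context: Let $N\ge2$ be an integer. An equation is given by real sequences $f=\{f_n\}_{n=0}^N$, $q=\{q_n\}_{n=1}^N$, $w=\{w_n\}_{n=1}^N$ with $f_n\neq0$, $w_n>0$; it is $-\nabla(f_n\Delta y_n)+q_ny_n=\lambda w_ny_n$, $1\le n\le N$, for $y=\{y_n\}_{n=0}^{N+1}$, $\Delta y_n=y_{n+1}-y_n$, $\nabla y_n=y_n-y_{n-1}$. A boundary condition $[A\,|\,B]$ (equivalently the $2\times4$ coefficient matrix $(A,B)$ of rank 2) is $A(y_0,f_0\Delta y_0)^T+B(y_N,f_N\Delta y_N)^T=0$; matrices differing by left multiplication by an invertible $2\times2$ complex matrix give the same condition (so $\mathbf V_{-K}=\mathbf V_K$). $SL(2,\mathbb R)$: real $2\times2$ matrices of determinant 1; $I$ the identity. Eigenvalues ($\lambda$ with a nontrivial solution) are real; multiplicity = dimension of the solution space; counted with multiplicity they are ordered $\lambda_0\le\lambda_1\le\cdots$. *)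

theory Defs
  imports "HOL-Analysis.Analysis" "HOL-Library.Function_Algebras"
begin

text \<open>A boundary condition [A|B] is represented by the pair (A,B) of complex 2x2 matrices.
  A solution y = (y_0,...,y_{N+1}) is represented by a function nat => complex vanishing
  beyond index N+1, so the solutions form a complex vector space under pointwise operations.\<close>

type_synonym bcond = "(complex^2^2) \<times> (complex^2^2)"

definition sl_sol_space ::
  "(nat \<Rightarrow> real) \<Rightarrow> (nat \<Rightarrow> real) \<Rightarrow> (nat \<Rightarrow> real) \<Rightarrow> nat \<Rightarrow> bcond \<Rightarrow> complex \<Rightarrow> (nat \<Rightarrow> complex) set"
where
  "sl_sol_space f q w N bc lam =
     {y. (\<forall>n>N+1. y n = 0)
       \<and> (\<forall>n\<in>{1..N}.
            - (complex_of_real (f n) * (y (Suc n) - y n) - complex_of_real (f (n-1)) * (y n - y (n-1)))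
            + complex_of_real (q n) * y n = lam * complex_of_real (w n) * y n)
       \<and> fst bc *v vector [y 0, complex_of_real (f 0) * (y 1 - y 0)]
         + snd bc *v vector [y N, complex_of_real (f N) * (y (Suc N) - y N)] = 0}"

definition seq_scale :: "complex \<Rightarrow> (nat \<Rightarrow> complex) \<Rightarrow> (nat \<Rightarrow> complex)" where
  "seq_scale c y = (\<lambda>n. c * y n)"

definition sl_is_eig :: "(nat \<Rightarrow> real) \<Rightarrow> (nat \<Rightarrow> real) \<Rightarrow> (nat \<Rightarrow> real) \<Rightarrow> nat \<Rightarrow> bcond \<Rightarrow> complex \<Rightarrow> bool" where
  "sl_is_eig f q w N bc lam \<longleftrightarrow> (\<exists>y\<in>sl_sol_space f q w N bc lam. y \<noteq> 0)"

definition sl_mult :: "(nat \<Rightarrow> real) \<Rightarrow> (nat \<Rightarrow> real) \<Rightarrow> (nat \<Rightarrow> real) \<Rightarrow> nat \<Rightarrow> bcond \<Rightarrow> complex \<Rightarrow> nat" where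
  "sl_mult f q w N bc lam = vector_space.dim seq_scale (sl_sol_space f q w N bc lam)"

definition sl_count :: "(nat \<Rightarrow> real) \<Rightarrow> (nat \<Rightarrow> real) \<Rightarrow> (nat \<Rightarrow> real) \<Rightarrow> nat \<Rightarrow> bcond \<Rightarrow> real \<Rightarrow> nat" where
  "sl_count f q w N bc x =
     (\<Sum>\<mu>\<in>{\<mu>::real. sl_is_eig f q w N bc (complex_of_real \<mu>) \<and> \<mu> \<le> x}.
        sl_mult f q w N bc (complex_of_real \<mu>))"

text \<open>The j-th eigenvalue (j = 0,1,...) in the nondecreasing list of eigenvalues
  counted with multiplicity: the least x such that more than j eigenvalues are \<le> x.\<close>
definition sl_eig :: "(nat \<Rightarrow> real) \<Rightarrow> (nat \<Rightarrow> real) \<Rightarrow> (nat \<Rightarrow> real) \<Rightarrow> nat \<Rightarrow> bcond \<Rightarrow> nat \<Rightarrow> real" where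
  "sl_eig f q w N bc j = Inf {x. j < sl_count f q w N bc x}"

definition cmat :: "real^2^2 \<Rightarrow> complex^2^2" where
  "cmat M = (\<chi> i j. complex_of_real (M$i$j))"

definition bc_coupled :: "complex^2^2 \<Rightarrow> bcond" where
  "bc_coupled A = (A, - mat 1)"

definition bc_V :: "real^2^2 \<Rightarrow> bcond" where
  "bc_V K = (cmat (\<chi> i j. if i = 1 then K$2$j else 0), cmat (\<chi> i j. if i = 2 \<and> j = 2 then 1 else 0))"

end

theory Submission
  imports Defs "HOL-Computational_Algebra.Fundamental_Theorem_Algebra"
begin

text \<open>
  Let \<open>\<Phi>(\<lambda>)\<close> be the transfer matrix taking \<open>(y\<^sub>0, f\<^sub>0 \<Delta>y\<^sub>0)\<close> to \<open>(y\<^sub>N, f\<^sub>N \<Delta>y\<^sub>N)\<close>; it has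
  determinant 1 and polynomial entries. The eigenvalues for \<open>[e\<^bsup>i\<gamma>\<^esup>M|-I]\<close> are the solutions of
  \<open>D(\<lambda>) = 2 cos \<gamma>\<close> with \<open>D = tr (M\<inverse> \<Phi>)\<close>, a polynomial of degree \<open>N\<close>. The Lagrange identity writes
  \<open>D'\<close> as a sum of values of a quadratic form of discriminant \<open>D\<^sup>2 - 4\<close>; where \<open>|D| \<le> 2\<close> this form
  is semidefinite, and a vanishing \<open>D'\<close> forces \<open>\<Phi> = \<plusminus>M\<close>, that is, a double eigenvalue.

  The eigenvalues for the separated condition are the zeros of a polynomial \<open>g\<close>, real and simple by
  Green's identity. At such a zero a fixed vector is an eigenvector of \<open>M\<inverse> \<Phi>\<close>, with eigenvalue \<open>s\<close>
  say, so \<open>D = s + 1/s\<close> and \<open>|D| \<ge> 2\<close>, while \<open>D g' < 0\<close>. Thus the sign of \<open>D\<close> alternates along the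
  zeros of \<open>g\<close>. Together with the behaviour of \<open>D\<close> at infinity this yields \<open>N\<close> consecutive bands,
  separated by the zeros of \<open>g\<close>, across each of which \<open>D\<close> runs between \<open>2\<close> and \<open>-2\<close>; a count of the
  roots of \<open>D - 2 cos \<gamma>\<close> with multiplicity shows that each band contributes exactly one eigenvalue.
\<close>

section \<open>Real polynomials\<close>

lemma map_poly_of_real_add:
  "map_poly of_real (p + q) = map_poly of_real p + (map_poly of_real q :: 'a::real_algebra_1 poly)"
  by (rule poly_eqI) (simp add: coeff_map_poly)

lemma map_poly_of_real_mult:
  "map_poly of_real (p * q) =
     map_poly of_real p * (map_poly of_real q :: 'a::{real_algebra_1, comm_ring_1} poly)"
  by (rule poly_eqI) (simp add: coeff_map_poly coeff_mult)

lemma map_poly_of_real_pderiv: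
  "map_poly of_real (pderiv p) = pderiv (map_poly of_real p :: 'a::{real_algebra_1, idom} poly)"
  by (rule poly_eqI) (simp add: coeff_map_poly coeff_pderiv)

lemma poly_map_poly_of_real:
  "poly (map_poly of_real p) (of_real x) = (of_real (poly p x) :: 'a::{real_algebra_1, comm_ring_1})"
  by (induction p) (simp_all add: map_poly_pCons)

lemma card_roots_eq_degree:
  fixes p :: "real poly"
  assumes real: "\<And>z. poly (map_poly complex_of_real p) z = 0 \<Longrightarrow> z \<in> \<real>"
    and simple: "\<And>x. poly p x = 0 \<Longrightarrow> poly (pderiv p) x \<noteq> 0"
  shows "card {x. poly p x = 0} = degree p"
proof -
  define P where "P = map_poly complex_of_real p"
  have P_of_real: "poly P (of_real x) = of_real (poly p x)" for x
    unfolding P_def by (rule poly_map_poly_of_real)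
  have "rsquarefree P"
    unfolding rsquarefree_roots
  proof (intro allI notI, elim conjE)
    fix z assume "poly P z = 0" "poly (pderiv P) z = 0"
    moreover from this obtain x where "z = of_real x"
      using real unfolding P_def by (auto elim: Reals_cases)
    ultimately show False
      using simple by (simp add: P_def poly_map_poly_of_real flip: map_poly_of_real_pderiv)
  qed
  then have "P \<noteq> 0" "smult (lead_coeff P) (\<Prod>z | poly P z = 0. [:- z, 1:]) = P"
    using complex_poly_decompose_rsquarefree by (auto simp: rsquarefree_def)
  then have "degree P = degree (\<Prod>z | poly P z = 0. [:- z, 1:])"
    by (metis degree_smult_eq leading_coeff_0_iff)
  also have "\<dots> = card {z. poly P z = 0}"
    by (subst degree_prod_sum_eq) auto
  also have "{z. poly P z = 0} = of_real ` {x. poly p x = 0}"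
    using real P_of_real unfolding P_def by (force elim!: Reals_cases)
  finally show ?thesis
    by (simp add: P_def degree_map_poly card_image inj_on_def)
qed

lemma poly_eq_prod_roots:
  fixes p :: "'a::idom poly"
  assumes "p \<noteq> 0" and card: "card {x. poly p x = 0} = degree p"
  shows "p = smult (lead_coeff p) (\<Prod>x | poly p x = 0. [:- x, 1:])"
proof (rule poly_eqI_degree_lead_coeff[where A = "{x. poly p x = 0}" and n = "degree p"])
  have fin: "finite {x. poly p x = 0}" using \<open>p \<noteq> 0\<close> by (rule poly_roots_finite)
  have deg: "degree (\<Prod>x | poly p x = 0. [:- x, 1:]) = degree p"
    using card by (subst degree_prod_sum_eq) auto
  then show "degree (smult (lead_coeff p) (\<Prod>x | poly p x = 0. [:- x, 1:])) \<le> degree p" by simp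
  show "coeff p (degree p) =
      coeff (smult (lead_coeff p) (\<Prod>x | poly p x = 0. [:- x, 1:])) (degree p)"
    using lead_coeff_prod[of "\<lambda>x. [:- x, 1:]" "{x. poly p x = 0}"] deg by simp
  show "poly p a = poly (smult (lead_coeff p) (\<Prod>x | poly p x = 0. [:- x, 1:])) a"
    if "a \<in> {x. poly p x = 0}" for a
    using that fin by (auto simp: poly_prod)
qed (use card in auto)

lemma poly_pderiv_root:
  fixes p :: "'a::idom poly"
  assumes "p \<noteq> 0" "card {x. poly p x = 0} = degree p" and a: "poly p a = 0"
  shows "poly (pderiv p) a = lead_coeff p * (\<Prod>x\<in>{x. poly p x = 0} - {a}. a - x)"
proof -
  let ?R = "{x. poly p x = 0}"
  have "(\<Prod>x\<in>?R. [:- x, 1:]) = [:- a, 1:] * (\<Prod>x\<in>?R - {a}. [:- x, 1:])"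
    using poly_roots_finite[OF \<open>p \<noteq> 0\<close>] a by (intro prod.remove) auto
  then have "p = smult (lead_coeff p) ([:- a, 1:] * (\<Prod>x\<in>?R - {a}. [:- x, 1:]))"
    using poly_eq_prod_roots[OF assms(1,2)] by simp
  then have "pderiv p = smult (lead_coeff p) (pderiv ([:- a, 1:] * (\<Prod>x\<in>?R - {a}. [:- x, 1:])))"
    by (simp flip: pderiv_smult)
  then show ?thesis unfolding pderiv_mult by (simp add: pderiv_pCons poly_prod)
qed

lemma prod_differences_sign:
  fixes \<nu> :: "nat \<Rightarrow> 'a::linordered_idom"
  assumes \<nu>: "strict_mono_on {..<d} \<nu>" and j: "j < d"
  shows "0 < (-1) ^ (d - Suc j) * (\<Prod>i\<in>{..<d} - {j}. \<nu> j - \<nu> i)"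
proof -
  have "{..<d} - {j} = {..<j} \<union> {Suc j..<d}" using j by auto
  then have "(\<Prod>i\<in>{..<d} - {j}. \<nu> j - \<nu> i) = (\<Prod>i<j. \<nu> j - \<nu> i) * (\<Prod>i=Suc j..<d. \<nu> j - \<nu> i)"
    using prod.union_disjoint[of "{..<j}" "{Suc j..<d}"] by fastforce
  also have "(\<Prod>i=Suc j..<d. \<nu> j - \<nu> i) = (-1) ^ (d - Suc j) * (\<Prod>i=Suc j..<d. \<nu> i - \<nu> j)"
    using prod.distrib[of "\<lambda>_. -1" "\<lambda>i. \<nu> i - \<nu> j" "{Suc j..<d}"] by simp
  finally have "(-1) ^ (d - Suc j) * (\<Prod>i\<in>{..<d} - {j}. \<nu> j - \<nu> i) =
      (\<Prod>i<j. \<nu> j - \<nu> i) * (\<Prod>i=Suc j..<d. \<nu> i - \<nu> j)"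
    by (simp add: mult.left_commute flip: mult.assoc power_add)
  also have "\<dots> > 0"
    using strict_mono_onD[OF \<nu>] j by (intro mult_pos_pos prod_pos) auto
  finally show ?thesis .
qed

lemma finite_strict_mono_enum:
  fixes A :: "'a::linorder set"
  assumes "finite A"
  obtains \<nu> :: "nat \<Rightarrow> 'a" where "strict_mono_on {..<card A} \<nu>" "\<nu> ` {..<card A} = A"
proof (rule that)
  show "strict_mono_on {..<card A} (\<lambda>i. sorted_list_of_set A ! i)"
    using strict_sorted_list_of_set[of A]
    by (auto intro!: strict_mono_onI simp: sorted_wrt_iff_nth_less)
  show "(\<lambda>i. sorted_list_of_set A ! i) ` {..<card A} = A"
    using assms nth_image[of "card A" "sorted_list_of_set A"] by (simp add: lessThan_atLeast0)
qed

lemma simple_real_roots_enum: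
  fixes p :: "real poly"
  assumes p: "p \<noteq> 0" "card {x. poly p x = 0} = degree p"
  obtains \<nu> :: "nat \<Rightarrow> real"
  where "strict_mono_on {..<degree p} \<nu>" "\<nu> ` {..<degree p} = {x. poly p x = 0}"
    and "\<And>j. j < degree p \<Longrightarrow>
          0 < (-1) ^ (degree p - Suc j) * lead_coeff p * poly (pderiv p) (\<nu> j)"
proof -
  obtain \<nu> :: "nat \<Rightarrow> real"
    where mono: "strict_mono_on {..<degree p} \<nu>" and range: "\<nu> ` {..<degree p} = {x. poly p x = 0}"
    using finite_strict_mono_enum[OF poly_roots_finite[OF p(1)]] unfolding p(2) by blast
  note inj = strict_mono_on_imp_inj_on[OF mono]
  have "0 < (-1) ^ (degree p - Suc j) * lead_coeff p * poly (pderiv p) (\<nu> j)"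
    if j: "j < degree p" for j
  proof -
    have "{x. poly p x = 0} - {\<nu> j} = \<nu> ` ({..<degree p} - {j})"
      using j inj unfolding range[symmetric] by (auto simp: inj_on_def)
    then have "poly (pderiv p) (\<nu> j) = lead_coeff p * (\<Prod>i\<in>{..<degree p} - {j}. \<nu> j - \<nu> i)"
      using poly_pderiv_root[OF p, of "\<nu> j"] j range inj_on_subset[OF inj, of "{..<degree p} - {j}"]
      by (auto simp: prod.reindex)
    then have "(-1) ^ (degree p - Suc j) * lead_coeff p * poly (pderiv p) (\<nu> j)
        = (lead_coeff p)\<^sup>2 * ((-1) ^ (degree p - Suc j) * (\<Prod>i\<in>{..<degree p} - {j}. \<nu> j - \<nu> i))"
      by (simp add: power2_eq_square algebra_simps)
    also have "\<dots> > 0"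
      using prod_differences_sign[OF mono j] p(1) by (intro mult_pos_pos[of "(lead_coeff p)\<^sup>2"]) auto
    finally show ?thesis .
  qed
  then show ?thesis using that mono range by blast
qed

lemma filterlim_poly_at_top:
  fixes p :: "real poly"
  assumes "degree p > 0" "lead_coeff p > 0"
  shows "filterlim (poly p) at_top at_top"
  unfolding filterlim_at_top eventually_at_top_linorder
proof
  fix c
  have "degree (p + [:- c:]) = degree p" using assms by (intro degree_add_eq_left) simp
  moreover from this have "lead_coeff (p + [:- c:]) = lead_coeff p"
    using assms by (simp add: coeff_eq_0)
  ultimately obtain T where "\<forall>x\<ge>T. poly (p + [:- c:]) x \<ge> lead_coeff p"
    using poly_pinfty_gt_lc[of "p + [:- c:]"] assms by auto
  then show "\<exists>T. \<forall>x\<ge>T. c \<le> poly p x" using assms(2) by (intro exI[of _ T]) force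
qed

lemma filterlim_poly_at_bot:
  fixes p :: "real poly"
  assumes "degree p > 0" "(-1) ^ degree p * lead_coeff p > 0"
  shows "filterlim (poly p) at_top at_bot"
proof -
  let ?r = "pcompose p [:0, -1:]"
  have "lead_coeff ?r = lead_coeff p * (-1) ^ degree p"
    by (subst lead_coeff_comp) simp_all
  then have "filterlim (poly ?r) at_top at_top"
    using assms by (intro filterlim_poly_at_top) (simp_all add: degree_pcompose mult.commute)
  then show ?thesis by (simp add: filterlim_at_bot_mirror poly_pcompose[abs_def])
qed

lemma two_le_order_iff:
  fixes p :: "'a::field_char_0 poly"
  assumes "p \<noteq> 0" "poly p x = 0"
  shows "2 \<le> order x p \<longleftrightarrow> poly (pderiv p) x = 0"
proof -
  have "degree p \<noteq> 0"
  proof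
    assume "degree p = 0"
    then obtain c where "p = [:c:]" by (rule degree_eq_zeroE)
    then show False using assms by simp
  qed
  then have "pderiv p \<noteq> 0" by (simp add: pderiv_eq_0_iff)
  then show ?thesis
    using order_pderiv[OF assms] order_root[of "pderiv p" x] by auto
qed

section \<open>Bands of a real polynomial\<close>

lemma last_crossing:
  fixes h :: "real \<Rightarrow> real"
  assumes cont: "continuous_on {a..b} h" and "a \<le> b" "c \<le> h a" "h b \<le> c"
  obtains x where "a \<le> x" "x \<le> b" "h x = c" "\<And>y. x < y \<Longrightarrow> y \<le> b \<Longrightarrow> h y < c"
proof -
  define S where "S = {a..b} \<inter> h -` {c..}"
  have "closed S" unfolding S_def by (rule continuous_closed_preimage[OF cont]) auto
  then have "compact S" unfolding compact_eq_bounded_closed S_def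
    by (auto intro: bounded_subset[of "{a..b}"])
  moreover have "a \<in> S" using assms by (simp add: S_def)
  ultimately obtain x where x: "x \<in> S" "\<And>y. y \<in> S \<Longrightarrow> y \<le> x"
    using compact_attains_sup[of S] by auto
  obtain y where "x \<le> y" "y \<le> b" "h y = c"
    using IVT2'[of h b c x] x(1) assms continuous_on_subset[OF cont, of "{x..b}"]
    by (auto simp: S_def)
  then have "h x = c" using x(1) x(2)[of y] by (auto simp: S_def)
  moreover have "h y < c" if "x < y" "y \<le> b" for y
    using x(1) x(2)[of y] that by (force simp: S_def)
  ultimately show ?thesis using that x(1) by (auto simp: S_def)
qed

lemma crossing_band:
  fixes h :: "real \<Rightarrow> real"
  assumes cont: "continuous_on {a..b} h" and ab: "a \<le> b" and h: "r \<le> h a" "h b \<le> - r" and r: "0 < r"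
  obtains \<alpha> \<beta> where "a \<le> \<alpha>" "\<alpha> < \<beta>" "\<beta> \<le> b" "h \<alpha> = r" "h \<beta> = - r"
    "\<And>x. \<alpha> < x \<Longrightarrow> x < \<beta> \<Longrightarrow> \<bar>h x\<bar> < r"
proof -
  obtain \<alpha> where \<alpha>: "a \<le> \<alpha>" "\<alpha> \<le> b" "h \<alpha> = r" "\<And>x. \<alpha> < x \<Longrightarrow> x \<le> b \<Longrightarrow> h x < r"
    using last_crossing[OF cont ab h(1)] h(2) r by auto
  have "continuous_on {- b..- \<alpha>} (\<lambda>x. - h (- x))"
    using \<alpha>(1) by (intro continuous_intros continuous_on_compose2[OF cont]) auto
  then obtain y where y: "- b \<le> y" "y \<le> - \<alpha>" "- h (- y) = r"
      "\<And>x. y < x \<Longrightarrow> x \<le> - \<alpha> \<Longrightarrow> - h (- x) < r"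
    using last_crossing[of "- b" "- \<alpha>" "\<lambda>x. - h (- x)" r] \<alpha>(2,3) h(2) r by auto
  show ?thesis
  proof (rule that[of \<alpha> "- y"])
    have "\<alpha> \<noteq> - y" using \<alpha>(3) y(3) r by auto
    then show "\<alpha> < - y" using y(2) by simp
    show "\<bar>h x\<bar> < r" if "\<alpha> < x" "x < - y" for x
      using \<alpha>(4)[of x] y(1) y(4)[of "- x"] that by simp
  qed (use \<alpha>(1,3) y(1,3) in auto)
qed

lemma count_image_mset_set:
  assumes "finite A"
  shows "count (image_mset f (mset_set A)) x = card {a \<in> A. f a = x}"
  using assms by (simp add: count_image_mset vimage_def Int_def conj_commute)

locale poly_bands =
  fixes p :: "real poly" and r :: real and n :: nat and \<alpha> \<beta> :: "nat \<Rightarrow> real"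
  assumes r_pos: "0 < r"
    and nontrivial: "j < n \<Longrightarrow> \<alpha> j < \<beta> j"
    and ordered: "i < j \<Longrightarrow> j < n \<Longrightarrow> \<beta> i \<le> \<alpha> j"
    and left_end: "j < n \<Longrightarrow> poly p (\<alpha> j) = r * (-1) ^ j"
    and right_end: "j < n \<Longrightarrow> poly p (\<beta> j) = - r * (-1) ^ j"
    and interior: "j < n \<Longrightarrow> \<alpha> j < x \<Longrightarrow> x < \<beta> j \<Longrightarrow> \<bar>poly p x\<bar> < r"

lemma poly_bands_exist:
  fixes p :: "real poly"
  assumes r: "0 < r"
    and t: "strict_mono_on {..n} t"
    and sign: "\<And>j. j \<le> n \<Longrightarrow> r \<le> (-1) ^ j * poly p (t j)"
  obtains \<alpha> \<beta> where "poly_bands p r n \<alpha> \<beta>"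
    "\<And>j. j < n \<Longrightarrow> t j \<le> \<alpha> j" "\<And>j. j < n \<Longrightarrow> \<beta> j \<le> t (Suc j)"
proof -
  define band where "band j \<alpha> \<beta> \<longleftrightarrow> t j \<le> \<alpha> \<and> \<alpha> < \<beta> \<and> \<beta> \<le> t (Suc j) \<and>
    (-1) ^ j * poly p \<alpha> = r \<and> (-1) ^ j * poly p \<beta> = - r \<and>
    (\<forall>x. \<alpha> < x \<longrightarrow> x < \<beta> \<longrightarrow> \<bar>(-1) ^ j * poly p x\<bar> < r)" for j \<alpha> \<beta>
  have "\<exists>\<alpha> \<beta>. band j \<alpha> \<beta>" if "j < n" for j
  proof (rule crossing_band)
    show "continuous_on {t j..t (Suc j)} (\<lambda>x. (-1) ^ j * poly p x)"
      by (intro continuous_intros)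
    show "t j \<le> t (Suc j)" using strict_mono_onD[OF t, of j "Suc j"] that by simp
    show "r \<le> (-1) ^ j * poly p (t j)" "(-1) ^ j * poly p (t (Suc j)) \<le> - r"
      using sign[of j] sign[of "Suc j"] that by simp_all
  qed (use r in \<open>auto simp: band_def\<close>)
  then obtain \<alpha> \<beta> where band: "\<And>j. j < n \<Longrightarrow> band j (\<alpha> j) (\<beta> j)" by metis
  have t_le: "t i \<le> t j" if "i \<le> j" "j \<le> n" for i j
    using mono_onD[OF strict_mono_on_imp_mono_on[OF t], of i j] that by simp
  have "poly_bands p r n \<alpha> \<beta>"
  proof
    have cancel: "(-1) ^ j * y = s \<Longrightarrow> y = s * (-1) ^ j" for j :: nat and y s :: real
      by (auto simp: minus_one_power_iff)
    show "poly p (\<alpha> j) = r * (-1) ^ j" "poly p (\<beta> j) = - r * (-1) ^ j" if "j < n" for j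
      using band[OF that] cancel unfolding band_def by blast+
    show "\<beta> i \<le> \<alpha> j" if "i < j" "j < n" for i j
      using band[of i] band[of j] t_le[of "Suc i" j] that unfolding band_def by force
    show "\<bar>poly p x\<bar> < r" if "j < n" "\<alpha> j < x" "x < \<beta> j" for j x
      using band[OF that(1)] that by (auto simp: band_def abs_mult power_abs)
  qed (use r band in \<open>auto simp: band_def\<close>)
  then show ?thesis using that band by (auto simp: band_def)
qed

context poly_bands
begin

lemma value_in_band:
  assumes "\<bar>c\<bar> \<le> r" and j: "j < n"
  shows "\<exists>x. \<alpha> j \<le> x \<and> x \<le> \<beta> j \<and> poly p x = c"
proof -
  have "\<exists>x\<ge>\<alpha> j. x \<le> \<beta> j \<and> (-1) ^ j * poly p x = (-1) ^ j * c"
    using assms nontrivial[OF j] left_end[OF j] right_end[OF j]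
    by (intro IVT2' continuous_intros) (auto simp: minus_one_power_iff)
  then show ?thesis by auto
qed

lemma common_point_critical:
  assumes "i < j" "j < n" and x: "x \<le> \<beta> i" "\<alpha> j \<le> x"
  shows "poly (pderiv p) x = 0"
proof -
  have ends: "\<beta> i = x" "\<alpha> j = x"
    using ordered[OF assms(1,2)] x by simp_all
  have at_x: "(poly p x)\<^sup>2 = r\<^sup>2"
    using left_end[OF assms(2)] unfolding ends by (simp add: power_mult_distrib flip: power_mult)
  have "(poly p y)\<^sup>2 \<le> r\<^sup>2" if "\<bar>x - y\<bar> < min (x - \<alpha> i) (\<beta> j - x)" for y
  proof (cases "y = x")
    case False
    then have "\<bar>poly p y\<bar> < r"
      using interior[of i y] interior[of j y] that assms(1,2) unfolding ends by (cases "y < x") auto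
    then show ?thesis using abs_le_square_iff[of "poly p y" r] r_pos by simp
  qed (use at_x in simp)
  with at_x have "\<forall>y. \<bar>x - y\<bar> < min (x - \<alpha> i) (\<beta> j - x) \<longrightarrow> poly (p\<^sup>2) y \<le> poly (p\<^sup>2) x"
    by simp
  then have "poly (pderiv (p\<^sup>2)) x = 0"
    using DERIV_local_max[OF poly_DERIV[of "p\<^sup>2" x], of "min (x - \<alpha> i) (\<beta> j - x)"]
      nontrivial[of i] nontrivial[of j] assms(1,2) unfolding ends by simp
  then show ?thesis
    using at_x r_pos by (auto simp: power2_eq_square pderiv_mult)
qed

lemma common_point_adjacent:
  assumes "i < j" "j < n" and x: "x \<le> \<beta> i" "\<alpha> j \<le> x"
  shows "j = Suc i"
proof (rule ccontr)
  assume "j \<noteq> Suc i"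
  then have "Suc i < j" using assms(1) by simp
  then have "\<beta> i < \<alpha> j"
    using ordered[of i "Suc i"] nontrivial[of "Suc i"] ordered[of "Suc i" j] assms(2) by simp
  then show False using x by simp
qed

context
  fixes c :: real and \<mu> :: "nat \<Rightarrow> real"
  assumes \<mu>_band: "\<And>j. j < n \<Longrightarrow> \<alpha> j \<le> \<mu> j \<and> \<mu> j \<le> \<beta> j"
    and \<mu>_value: "\<And>j. j < n \<Longrightarrow> poly p (\<mu> j) = c"
begin

lemma mono_on_band_points: "mono_on {..<n} \<mu>"
proof (rule mono_onI)
  fix i j assume "i \<in> {..<n}" "j \<in> {..<n}" "i \<le> j"
  then show "\<mu> i \<le> \<mu> j"
    using \<mu>_band[of i] \<mu>_band[of j] ordered[of i j] by (cases "i = j") auto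
qed

lemma count_band_points_le: "count (image_mset \<mu> (mset_set {..<n})) x \<le> 2"
proof (cases "\<exists>i<n. \<mu> i = x")
  case True
  define m where "m = (LEAST i. i < n \<and> \<mu> i = x)"
  have m: "m < n" "\<mu> m = x" "\<And>i. i < n \<Longrightarrow> \<mu> i = x \<Longrightarrow> m \<le> i"
    using LeastI_ex[OF True] unfolding m_def by (auto intro: Least_le)
  have "i \<in> {m, Suc m}" if "i < n" "\<mu> i = x" for i
    using common_point_adjacent[of m i x] m(3)[OF that] \<mu>_band[of m] \<mu>_band[of i] m(1,2) that
    by (cases "m = i") auto
  then have "card {i \<in> {..<n}. \<mu> i = x} \<le> card {m, Suc m}" by (intro card_mono) auto
  then show ?thesis by (simp add: count_image_mset_set)
next
  case False
  then have "{i \<in> {..<n}. \<mu> i = x} = {}" by blast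
  then show ?thesis by (simp only: count_image_mset_set finite_lessThan) simp
qed

lemma count_band_points_le_order:
  assumes "p \<noteq> [:c:]"
  shows "count (image_mset \<mu> (mset_set {..<n})) x \<le> order x (p - [:c:])"
proof -
  define g where "g = p - [:c:]"
  have "g \<noteq> 0" using assms by (simp add: g_def)
  have root: "poly g (\<mu> j) = 0" if "j < n" for j using \<mu>_value[OF that] by (simp add: g_def)
  show ?thesis
  proof (cases "\<exists>i j. i < j \<and> j < n \<and> \<mu> i = x \<and> \<mu> j = x")
    case True
    then obtain i j where ij: "i < j" "j < n" "\<mu> i = x" "\<mu> j = x" by blast
    then have "poly (pderiv g) x = 0"
      using common_point_critical[OF ij(1,2)] \<mu>_band[of i] \<mu>_band[of j]
      by (simp add: g_def pderiv_diff pderiv_pCons)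
    then have "2 \<le> order x g"
      using two_le_order_iff[OF \<open>g \<noteq> 0\<close>, of x] root[of j] ij by simp
    then show ?thesis using count_band_points_le[of x] by (simp add: g_def)
  next
    case False
    then have "i = j" if "i < n" "j < n" "\<mu> i = x" "\<mu> j = x" for i j
      using that by (metis linorder_neqE_nat)
    then have "count (image_mset \<mu> (mset_set {..<n})) x \<le> 1"
      by (auto simp: count_image_mset_set card_le_Suc0_iff_eq)
    moreover have "order x g \<noteq> 0" if "count (image_mset \<mu> (mset_set {..<n})) x \<noteq> 0"
    proof -
      have "x \<in># image_mset \<mu> (mset_set {..<n})" using that by (meson not_in_iff)
      then show ?thesis using root \<open>g \<noteq> 0\<close> by (auto simp: order_root)
    qed
    ultimately show ?thesis unfolding g_def by linarith
  qed
qed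

text \<open>The chosen points are roots, multiple ones where two bands meet, so they exhaust the degree.\<close>

lemma proots_band_points:
  assumes deg: "degree p = n" "0 < n"
  shows "proots (p - [:c:]) = image_mset \<mu> (mset_set {..<n})"
proof -
  have "p \<noteq> [:c:]" using deg by auto
  then have "image_mset \<mu> (mset_set {..<n}) \<subseteq># proots (p - [:c:])"
    using count_band_points_le_order by (intro mset_subset_eqI) simp
  moreover have "degree (p - [:c:]) = n"
    using deg degree_add_eq_left[of "- [:c:]" p] by (simp del: minus_pCons)
  then have "size (proots (p - [:c:])) \<le> size (image_mset \<mu> (mset_set {..<n}))"
    using size_proots_le[of "p - [:c:]"] by simp
  ultimately show ?thesis
    by (metis mset_subset_size not_le subset_mset.le_neq_trans)
qed

end

end

lemma alternating_points_extend:
  fixes p :: "real poly" and \<nu> :: "nat \<Rightarrow> real"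
  assumes deg: "degree p = n" "0 < n" and lead: "0 < (-1) ^ n * lead_coeff p"
    and \<nu>: "strict_mono_on {..<d} \<nu>" "\<And>j. j < d \<Longrightarrow> r \<le> (-1) ^ (j + e) * poly p (\<nu> j)"
    and e: "e \<le> 1" and d: "n \<le> d + e" "d + e \<le> Suc n"
  obtains t where "strict_mono_on {..n} t" "\<And>j. j \<le> n \<Longrightarrow> r \<le> (-1) ^ j * poly p (t j)"
    "\<And>j. j < d \<Longrightarrow> t (j + e) = \<nu> j"
proof -
  have "filterlim (poly (smult ((-1) ^ n) p)) at_top at_top"
    using deg lead by (intro filterlim_poly_at_top) auto
  then have "eventually (\<lambda>x. r \<le> (-1) ^ n * poly p x \<and> (\<forall>j\<in>{..<d}. \<nu> j < x)) at_top"
    by (intro eventually_conj eventually_ball_finite)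
      (auto simp: filterlim_at_top eventually_gt_at_top)
  then obtain b where b: "r \<le> (-1) ^ n * poly p b" "\<And>j. j < d \<Longrightarrow> \<nu> j < b"
    by (auto dest!: eventually_happens)
  have "filterlim (poly p) at_top at_bot"
    using deg lead by (intro filterlim_poly_at_bot) auto
  then have "eventually (\<lambda>x. r \<le> poly p x \<and> x < b \<and> (\<forall>j\<in>{..<d}. x < \<nu> j)) at_bot"
    by (intro eventually_conj eventually_ball_finite)
      (auto simp: filterlim_at_top eventually_gt_at_bot)
  then obtain a where a: "r \<le> poly p a" "a < b" "\<And>j. j < d \<Longrightarrow> a < \<nu> j"
    by (auto dest!: eventually_happens)
  define t where "t j = (if j < e then a else if j < d + e then \<nu> (j - e) else b)" for j
  show ?thesis
  proof (rule that[of t])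
    show "strict_mono_on {..n} t"
      using a b(2) e d strict_mono_onD[OF \<nu>(1)]
      by (intro strict_mono_onI) (auto simp: t_def not_less le_less_trans)
    show "r \<le> (-1) ^ j * poly p (t j)" if j: "j \<le> n" for j
    proof -
      consider "j = 0" "j < e" | "e \<le> j" "j < d + e" | "\<not> j < e" "\<not> j < d + e" "j = n"
        using e d j by linarith
      then show ?thesis
        using a(1) b(1) \<nu>(2)[of "j - e"] by cases (auto simp: t_def)
    qed
  qed (simp add: t_def)
qed

section \<open>The initial value problem\<close>

text \<open>The polynomials in \<open>\<lambda>\<close> giving \<open>y\<^sub>n\<close> and \<open>f\<^sub>n \<Delta>y\<^sub>n\<close> when \<open>(y\<^sub>0, f\<^sub>0 \<Delta>y\<^sub>0) = (a, b)\<close>.\<close>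

fun ivp_sol :: "(nat \<Rightarrow> 'a::field) \<Rightarrow> (nat \<Rightarrow> 'a) \<Rightarrow> (nat \<Rightarrow> 'a) \<Rightarrow> 'a \<Rightarrow> 'a \<Rightarrow> nat \<Rightarrow> 'a poly"
  and ivp_quasi :: "(nat \<Rightarrow> 'a::field) \<Rightarrow> (nat \<Rightarrow> 'a) \<Rightarrow> (nat \<Rightarrow> 'a) \<Rightarrow> 'a \<Rightarrow> 'a \<Rightarrow> nat \<Rightarrow> 'a poly"
where
  "ivp_sol f q w a b 0 = [:a:]"
| "ivp_quasi f q w a b 0 = [:b:]"
| "ivp_sol f q w a b (Suc n) = ivp_sol f q w a b n + smult (1 / f n) (ivp_quasi f q w a b n)"
| "ivp_quasi f q w a b (Suc n) =
     ivp_quasi f q w a b n + [:q (Suc n), - w (Suc n):] * ivp_sol f q w a b (Suc n)"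

lemmas ivp_sol_Suc = ivp_sol.simps(2)
lemmas ivp_quasi_Suc = ivp_quasi.simps(2)

declare ivp_sol_Suc [simp del] ivp_quasi_Suc [simp del]

lemma poly_ivp_sol_Suc:
  "poly (ivp_sol f q w a b (Suc n)) x =
     poly (ivp_sol f q w a b n) x + poly (ivp_quasi f q w a b n) x / f n"
  by (simp add: ivp_sol_Suc)

lemma poly_ivp_quasi_Suc:
  "poly (ivp_quasi f q w a b (Suc n)) x =
     poly (ivp_quasi f q w a b n) x + (q (Suc n) - x * w (Suc n)) * poly (ivp_sol f q w a b (Suc n)) x"
  by (simp add: ivp_quasi_Suc algebra_simps)

lemma ivp_superposition:
  shows poly_ivp_sol_superposition:
    "poly (ivp_sol f q w a b n) x =
       a * poly (ivp_sol f q w 1 0 n) x + b * poly (ivp_sol f q w 0 1 n) x"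
  and poly_ivp_quasi_superposition:
    "poly (ivp_quasi f q w a b n) x =
       a * poly (ivp_quasi f q w 1 0 n) x + b * poly (ivp_quasi f q w 0 1 n) x"
proof (induction n)
  case (Suc n)
  show sol: "poly (ivp_sol f q w a b (Suc n)) x =
      a * poly (ivp_sol f q w 1 0 (Suc n)) x + b * poly (ivp_sol f q w 0 1 (Suc n)) x"
    using Suc by (simp add: poly_ivp_sol_Suc algebra_simps add_divide_distrib)
  show "poly (ivp_quasi f q w a b (Suc n)) x =
      a * poly (ivp_quasi f q w 1 0 (Suc n)) x + b * poly (ivp_quasi f q w 0 1 (Suc n)) x"
    using Suc sol by (simp add: poly_ivp_quasi_Suc algebra_simps)
qed simp_all

lemma
  fixes f q w :: "nat \<Rightarrow> real"
  defines "emb \<equiv> (\<lambda>s n. of_real (s n) :: 'a::real_field)"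
  shows ivp_sol_of_real:
    "ivp_sol (emb f) (emb q) (emb w) (of_real a) (of_real b) n =
       map_poly of_real (ivp_sol f q w a b n)"
  and ivp_quasi_of_real:
    "ivp_quasi (emb f) (emb q) (emb w) (of_real a) (of_real b) n =
       map_poly of_real (ivp_quasi f q w a b n)"
proof (induction n)
  case (Suc n)
  show sol: "ivp_sol (emb f) (emb q) (emb w) (of_real a) (of_real b) (Suc n) =
      map_poly of_real (ivp_sol f q w a b (Suc n))"
    using Suc by (simp add: ivp_sol_Suc emb_def map_poly_of_real_add map_poly_smult)
  show "ivp_quasi (emb f) (emb q) (emb w) (of_real a) (of_real b) (Suc n) =
      map_poly of_real (ivp_quasi f q w a b (Suc n))"
    unfolding ivp_quasi_Suc sol Suc map_poly_of_real_add map_poly_of_real_mult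
    by (simp add: emb_def map_poly_pCons)
qed (simp_all add: map_poly_pCons)

lemma green_identity:
  "poly (ivp_sol f q w a b n) x * poly (ivp_quasi f q w c d n) y
     - poly (ivp_sol f q w c d n) y * poly (ivp_quasi f q w a b n) x
   = a * d - b * c
     + (x - y) * (\<Sum>k=1..n. w k * (poly (ivp_sol f q w a b k) x * poly (ivp_sol f q w c d k) y))"
proof (induction n)
  case (Suc n)
  let ?u = "\<lambda>k. poly (ivp_sol f q w a b k) x" and ?v = "\<lambda>k. poly (ivp_quasi f q w a b k) x"
  let ?u' = "\<lambda>k. poly (ivp_sol f q w c d k) y" and ?v' = "\<lambda>k. poly (ivp_quasi f q w c d k) y"
  have "?u (Suc n) * ?v' (Suc n) - ?u' (Suc n) * ?v (Suc n)
      = ?u (Suc n) * ?v' n - ?u' (Suc n) * ?v n + (x - y) * (w (Suc n) * (?u (Suc n) * ?u' (Suc n)))"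
    unfolding poly_ivp_quasi_Suc by algebra
  also have "?u (Suc n) * ?v' n - ?u' (Suc n) * ?v n = ?u n * ?v' n - ?u' n * ?v n"
    unfolding poly_ivp_sol_Suc by (simp add: algebra_simps)
  also note Suc
  finally show ?case by (simp add: algebra_simps)
qed (simp add: algebra_simps)

lemma lagrange_identity:
  fixes f q w :: "nat \<Rightarrow> 'a::field_char_0"
  shows "poly (pderiv (ivp_sol f q w a b n)) x * poly (ivp_quasi f q w c d n) x
     - poly (ivp_sol f q w c d n) x * poly (pderiv (ivp_quasi f q w a b n)) x
   = (\<Sum>k=1..n. w k * (poly (ivp_sol f q w a b k) x * poly (ivp_sol f q w c d k) x))"
proof -
  let ?S = "\<Sum>k=1..n. smult (w k * poly (ivp_sol f q w c d k) x) (ivp_sol f q w a b k)"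
  have "smult (poly (ivp_quasi f q w c d n) x) (ivp_sol f q w a b n)
      - smult (poly (ivp_sol f q w c d n) x) (ivp_quasi f q w a b n)
    = [:a * d - b * c:] + [:- x, 1:] * ?S"
  proof (rule poly_eq_poly_eq_iff[THEN iffD1], rule ext)
    fix t
    show "poly (smult (poly (ivp_quasi f q w c d n) x) (ivp_sol f q w a b n)
        - smult (poly (ivp_sol f q w c d n) x) (ivp_quasi f q w a b n)) t
      = poly ([:a * d - b * c:] + [:- x, 1:] * ?S) t"
      using green_identity[of f q w a b n t c d x]
      by (simp add: poly_sum sum_distrib_left algebra_simps)
  qed
  then have "poly (pderiv (smult (poly (ivp_quasi f q w c d n) x) (ivp_sol f q w a b n)
      - smult (poly (ivp_sol f q w c d n) x) (ivp_quasi f q w a b n))) x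
    = poly (pderiv ([:a * d - b * c:] + [:- x, 1:] * ?S)) x"
    by (rule arg_cong)
  then show ?thesis
    unfolding pderiv_add pderiv_diff pderiv_mult pderiv_smult
    by (simp add: pderiv_pCons poly_sum mult_ac)
qed

lemma
  assumes "ivp_sol f q w a b (Suc m) = [:c:]" "ivp_quasi f q w a b m = [:d:]"
  shows degree_ivp_sol_from: "degree (ivp_sol f q w a b (Suc (m + n))) \<le> n"
    and degree_ivp_quasi_from: "degree (ivp_quasi f q w a b (Suc (m + n))) \<le> Suc n"
    and coeff_ivp_quasi_from: "coeff (ivp_quasi f q w a b (Suc (m + n))) (Suc n) =
      c * (\<Prod>k=Suc m..Suc (m + n). - w k) * (\<Prod>k=Suc m..m + n. 1 / f k)"
proof (induction n)
  case 0
  show "degree (ivp_sol f q w a b (Suc (m + 0))) \<le> 0" using assms by simp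
  show "degree (ivp_quasi f q w a b (Suc (m + 0))) \<le> Suc 0"
    "coeff (ivp_quasi f q w a b (Suc (m + 0))) (Suc 0) =
      c * (\<Prod>k=Suc m..Suc (m + 0). - w k) * (\<Prod>k=Suc m..m + 0. 1 / f k)"
    using assms by (simp_all add: ivp_quasi_Suc)
next
  case (Suc n)
  let ?u = "ivp_sol f q w a b" and ?v = "ivp_quasi f q w a b" and ?m = "Suc (m + n)"
  show u: "degree (?u (Suc (m + Suc n))) \<le> Suc n"
    using Suc(1,2) ivp_sol_Suc[of f q w a b ?m]
    by (auto intro!: degree_add_le order.trans[OF degree_smult_le])
  have "degree ([:q (Suc ?m), - w (Suc ?m):] * ?u (Suc ?m)) \<le> 1 + Suc n"
    using u by (intro order.trans[OF degree_mult_le] add_mono) simp_all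
  then show "degree (?v (Suc (m + Suc n))) \<le> Suc (Suc n)"
    using Suc(2) ivp_quasi_Suc[of f q w a b ?m] by (auto intro!: degree_add_le)
  have "coeff (?v ?m) (Suc (Suc n)) = 0" "coeff (?u ?m) (Suc n) = 0"
    "coeff (?u (Suc ?m)) (Suc (Suc n)) = 0"
    using Suc(1,2) u by (auto intro: coeff_eq_0)
  then have "coeff (?v (Suc ?m)) (Suc (Suc n)) = - w (Suc ?m) * (coeff (?v ?m) (Suc n) / f ?m)"
    by (simp add: ivp_quasi_Suc[of f q w a b ?m] ivp_sol_Suc[of f q w a b ?m])
  then show "coeff (?v (Suc (m + Suc n))) (Suc (Suc n)) =
      c * (\<Prod>k=Suc m..Suc (m + Suc n). - w k) * (\<Prod>k=Suc m..m + Suc n. 1 / f k)"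
    using Suc(3) by (simp add: algebra_simps)
qed

lemma ivp_sol_nontrivial:
  assumes "f 0 \<noteq> 0" "f 1 \<noteq> 0" "(a, b) \<noteq> (0, 0)" "2 \<le> n"
  shows "\<exists>k\<in>{1..n}. poly (ivp_sol f q w a b k) x \<noteq> 0"
proof -
  have "poly (ivp_sol f q w a b 1) x \<noteq> 0 \<or> poly (ivp_sol f q w a b 2) x \<noteq> 0"
    using assms by (auto simp: poly_ivp_sol_Suc poly_ivp_quasi_Suc numeral_2_eq_2)
  moreover have "1 \<in> {1..n}" "2 \<in> {1..n}" using assms by auto
  ultimately show ?thesis by blast
qed

definition transfer_matrix ::
  "(nat \<Rightarrow> 'a::field) \<Rightarrow> (nat \<Rightarrow> 'a) \<Rightarrow> (nat \<Rightarrow> 'a) \<Rightarrow> nat \<Rightarrow> 'a \<Rightarrow> 'a^2^2"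
where
  "transfer_matrix f q w n x = vector
     [vector [poly (ivp_sol f q w 1 0 n) x, poly (ivp_sol f q w 0 1 n) x],
      vector [poly (ivp_quasi f q w 1 0 n) x, poly (ivp_quasi f q w 0 1 n) x]]"

lemma transfer_matrix_mult_vec:
  "transfer_matrix f q w n x *v v =
     vector [poly (ivp_sol f q w (v $ 1) (v $ 2) n) x, poly (ivp_quasi f q w (v $ 1) (v $ 2) n) x]"
  using ivp_superposition[of f q w "v $ 1" "v $ 2" n x]
  by (simp add: transfer_matrix_def vec_eq_iff forall_2 matrix_vector_mult_def sum_2 mult.commute)

lemma det_transfer_matrix: "det (transfer_matrix f q w n x) = 1"
  using green_identity[of f q w 1 0 n x 0 1 x] by (simp add: transfer_matrix_def det_2)

section \<open>Eigenvalues and multiplicities\<close>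

lemma dim_kernel_2:
  fixes T :: "'a::field^2^2"
  shows "vec.dim {v. T *v v = 0} = (if det T \<noteq> 0 then 0 else if T = 0 then 2 else 1)"
proof -
  let ?K = "{v. T *v v = 0}"
  have sub: "vec.subspace ?K"
    by (simp add: vec.subspace_def matrix_vector_right_distrib vec.scale)
  have "vec.dim ?K = 0 \<longleftrightarrow> det T \<noteq> 0"
    using vec.dim_eq_0[of ?K] invertible_det_nz[of T]
    by (auto simp: invertible_left_inverse matrix_left_invertible_ker)
  moreover have "vec.dim ?K = 2 \<longleftrightarrow> T = 0"
  proof -
    have "vec.dim ?K = 2 \<longleftrightarrow> ?K = UNIV"
      using vec.dim_eq_full[of ?K] sub
      by (simp add: vec.dimension_def card_cart_basis vec.span_eq_iff[THEN iffD2])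
    also have "\<dots> \<longleftrightarrow> T = 0"
      using matrix_eq[of T 0] by auto
    finally show ?thesis .
  qed
  moreover have "vec.dim ?K \<le> 2"
    using dim_subset_UNIV_cart_gen[of ?K] by simp
  ultimately show ?thesis by (auto simp del: vec.dim_eq_0)
qed

abbreviation cseq :: "(nat \<Rightarrow> real) \<Rightarrow> nat \<Rightarrow> complex" where
  "cseq s \<equiv> \<lambda>n. complex_of_real (s n)"

definition ivp_seq ::
  "(nat \<Rightarrow> real) \<Rightarrow> (nat \<Rightarrow> real) \<Rightarrow> (nat \<Rightarrow> real) \<Rightarrow> nat \<Rightarrow> complex \<Rightarrow> complex^2 \<Rightarrow> nat \<Rightarrow> complex"
where
  "ivp_seq f q w N x v n =
     (if n \<le> Suc N then poly (ivp_sol (cseq f) (cseq q) (cseq w) (v $ 1) (v $ 2) n) x else 0)"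

definition boundary_matrix ::
  "(nat \<Rightarrow> real) \<Rightarrow> (nat \<Rightarrow> real) \<Rightarrow> (nat \<Rightarrow> real) \<Rightarrow> nat \<Rightarrow> bcond \<Rightarrow> complex \<Rightarrow> complex^2^2"
where
  "boundary_matrix f q w N bc x =
     fst bc + snd bc ** transfer_matrix (cseq f) (cseq q) (cseq w) N x"

lemma quasi_difference_ivp_sol:
  "f n \<noteq> 0 \<Longrightarrow> f n * (poly (ivp_sol f q w a b (Suc n)) x - poly (ivp_sol f q w a b n) x) =
     poly (ivp_quasi f q w a b n) x"
  by (simp add: poly_ivp_sol_Suc)

definition sl_equation ::
  "(nat \<Rightarrow> 'a::field) \<Rightarrow> (nat \<Rightarrow> 'a) \<Rightarrow> (nat \<Rightarrow> 'a) \<Rightarrow> 'a \<Rightarrow> (nat \<Rightarrow> 'a) \<Rightarrow> nat \<Rightarrow> bool"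
where
  "sl_equation f q w x y n \<longleftrightarrow>
     - (f n * (y (Suc n) - y n) - f (n - 1) * (y n - y (n - 1))) + q n * y n = x * w n * y n"

lemma sl_equation_iff_ivp_sol:
  fixes f q w y :: "nat \<Rightarrow> 'a::field" and x :: 'a
  assumes "\<forall>n\<le>N. f n \<noteq> 0"
  defines "u \<equiv> \<lambda>n. poly (ivp_sol f q w (y 0) (f 0 * (y 1 - y 0)) n) x"
  shows "(\<forall>n\<in>{1..N}. sl_equation f q w x y n) \<longleftrightarrow> (\<forall>n\<le>Suc N. y n = u n)"
  using assms(1)
proof (induction N)
  case 0
  then show ?case by (simp add: u_def poly_ivp_sol_Suc le_Suc_eq)
next
  case (Suc N)
  let ?eq = "sl_equation f q w x y"
  define v where "v n = poly (ivp_quasi f q w (y 0) (f 0 * (y 1 - y 0)) n) x" for n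
  have next_value: "?eq (Suc N) \<longleftrightarrow> y (Suc (Suc N)) = u (Suc (Suc N))" if y: "\<forall>n\<le>Suc N. y n = u n"
  proof -
    have quasi: "f n * (u (Suc n) - u n) = v n" if "n \<le> Suc N" for n
      using Suc.prems that unfolding u_def v_def by (intro quasi_difference_ivp_sol) blast
    have "?eq (Suc N) \<longleftrightarrow>
        f (Suc N) * (y (Suc (Suc N)) - u (Suc N)) = v N + (q (Suc N) - x * w (Suc N)) * u (Suc N)"
      using y quasi[of N] by (simp add: sl_equation_def algebra_simps) (metis add.commute)
    also have "v N + (q (Suc N) - x * w (Suc N)) * u (Suc N) =
        f (Suc N) * (u (Suc (Suc N)) - u (Suc N))"
      using quasi[of "Suc N"] by (simp add: u_def v_def poly_ivp_quasi_Suc)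
    finally show ?thesis using Suc.prems by simp
  qed
  have "(\<forall>n\<in>{1..Suc N}. ?eq n) \<longleftrightarrow> (\<forall>n\<in>{1..N}. ?eq n) \<and> ?eq (Suc N)"
    by (simp only: atLeastAtMostSuc_conv[of 1 N] ball_simps) blast
  also have "\<dots> \<longleftrightarrow> (\<forall>n\<le>Suc N. y n = u n) \<and> ?eq (Suc N)"
    using Suc by simp
  also have "\<dots> \<longleftrightarrow> (\<forall>n\<le>Suc N. y n = u n) \<and> y (Suc (Suc N)) = u (Suc (Suc N))"
    by (rule conj_cong[OF refl next_value])
  also have "\<dots> \<longleftrightarrow> (\<forall>n\<le>Suc (Suc N). y n = u n)"
    by (auto simp only: le_Suc_eq[of _ "Suc N"])
  finally show ?case .
qed

lemma eq_ivp_seq_iff: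
  assumes f: "\<forall>n\<le>N. f n \<noteq> 0"
  shows "y = ivp_seq f q w N x (vector [y 0, cseq f 0 * (y 1 - y 0)]) \<longleftrightarrow>
    (\<forall>n>N + 1. y n = 0) \<and> (\<forall>n\<in>{1..N}. sl_equation (cseq f) (cseq q) (cseq w) x y n)"
proof -
  let ?u = "\<lambda>n. poly (ivp_sol (cseq f) (cseq q) (cseq w) (y 0) (cseq f 0 * (y 1 - y 0)) n) x"
  have "ivp_seq f q w N x (vector [y 0, cseq f 0 * (y 1 - y 0)]) n =
      (if n \<le> Suc N then ?u n else 0)" for n
    by (simp add: ivp_seq_def)
  then have "y = ivp_seq f q w N x (vector [y 0, cseq f 0 * (y 1 - y 0)]) \<longleftrightarrow>
      (\<forall>n>N + 1. y n = 0) \<and> (\<forall>n\<le>Suc N. y n = ?u n)"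
    by (auto simp: fun_eq_iff not_le)
  also have "(\<forall>n\<le>Suc N. y n = ?u n) \<longleftrightarrow>
      (\<forall>n\<in>{1..N}. sl_equation (cseq f) (cseq q) (cseq w) x y n)"
    by (rule sl_equation_iff_ivp_sol[symmetric]) (use f in simp)
  finally show ?thesis .
qed

lemma sl_sol_space_eq_ivp_seq:
  assumes f: "\<forall>n\<le>N. f n \<noteq> 0"
  shows "sl_sol_space f q w N bc x = ivp_seq f q w N x ` {v. boundary_matrix f q w N bc x *v v = 0}"
proof -
  define s where "s = ivp_seq f q w N x"
  define init where "init y = (vector [y 0, cseq f 0 * (y 1 - y 0)] :: complex^2)"
    for y :: "nat \<Rightarrow> complex"
  define final where "final y = (vector [y N, cseq f N * (y (Suc N) - y N)] :: complex^2)" for y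
  have init_s: "init (s v) = v" for v
    using f by (simp add: s_def init_def ivp_seq_def poly_ivp_sol_Suc vec_eq_iff forall_2)
  have final_s: "final (s v) = transfer_matrix (cseq f) (cseq q) (cseq w) N x *v v" for v
    using f quasi_difference_ivp_sol[of "cseq f" N]
    by (simp add: s_def final_def ivp_seq_def transfer_matrix_mult_vec vec_eq_iff forall_2)
  have boundary: "fst bc *v init (s v) + snd bc *v final (s v) = boundary_matrix f q w N bc x *v v"
    for v
    unfolding init_s final_s boundary_matrix_def
    by (simp add: matrix_vector_mult_add_rdistrib matrix_vector_mul_assoc)
  have mem: "y \<in> sl_sol_space f q w N bc x \<longleftrightarrow>
      y = s (init y) \<and> fst bc *v init y + snd bc *v final y = 0" for y
    unfolding s_def init_def eq_ivp_seq_iff[OF f]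
    by (simp add: sl_sol_space_def sl_equation_def final_def conj_assoc)
  have "sl_sol_space f q w N bc x = s ` {v. boundary_matrix f q w N bc x *v v = 0}"
  proof (intro equalityI subsetI)
    fix y assume "y \<in> sl_sol_space f q w N bc x"
    then have "y = s (init y)" "boundary_matrix f q w N bc x *v init y = 0"
      using mem[of y] boundary[of "init y"] by simp_all
    then show "y \<in> s ` {v. boundary_matrix f q w N bc x *v v = 0}" by blast
  qed (use mem boundary init_s in auto)
  then show ?thesis unfolding s_def .
qed

interpretation seq: vector_space seq_scale
  by unfold_locales (auto simp: seq_scale_def fun_eq_iff algebra_simps)

interpretation vec_seq: finite_dimensional_vector_space_pair_1
  "(*s) :: complex \<Rightarrow> complex^2 \<Rightarrow> complex^2" cart_basis seq_scale ..

lemma linear_ivp_seq: "Vector_Spaces.linear (*s) seq_scale (ivp_seq f q w N x)"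
proof -
  have decomposition: "ivp_seq f q w N x v n =
      v $ 1 * ivp_seq f q w N x (vector [1, 0]) n + v $ 2 * ivp_seq f q w N x (vector [0, 1]) n"
    for v n
    by (simp add: ivp_seq_def poly_ivp_sol_superposition[of _ _ _ "v $ 1" "v $ 2"])
  show ?thesis
    unfolding Vector_Spaces.linear_iff
  proof (intro conjI allI vec.vector_space_axioms seq.vector_space_axioms ext)
    fix v v' c n
    show "ivp_seq f q w N x (v + v') n = (ivp_seq f q w N x v + ivp_seq f q w N x v') n"
      unfolding plus_fun_apply
      by (subst (1 2 3) decomposition) (simp add: algebra_simps)
    show "ivp_seq f q w N x (c *s v) n = seq_scale c (ivp_seq f q w N x v) n"
      unfolding seq_scale_def
      by (subst (1 2) decomposition) (simp add: algebra_simps)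
  qed
qed

lemma inj_ivp_seq:
  assumes "f 0 \<noteq> 0"
  shows "inj (ivp_seq f q w N x)"
proof (rule injI)
  fix v v' assume "ivp_seq f q w N x v = ivp_seq f q w N x v'"
  then have "ivp_seq f q w N x v 0 = ivp_seq f q w N x v' 0"
    "ivp_seq f q w N x v 1 = ivp_seq f q w N x v' 1" by simp_all
  then show "v = v'"
    using assms by (simp add: ivp_seq_def poly_ivp_sol_Suc vec_eq_iff forall_2)
qed

lemma sl_mult_eq:
  assumes "\<forall>n\<le>N. f n \<noteq> 0"
  shows "sl_mult f q w N bc x =
    (if det (boundary_matrix f q w N bc x) \<noteq> 0 then 0
     else if boundary_matrix f q w N bc x = 0 then 2 else 1)"
  unfolding sl_mult_def sl_sol_space_eq_ivp_seq[OF assms] dim_kernel_2[symmetric]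
  using assms by (intro vec_seq.dim_image_eq linear_ivp_seq inj_on_subset[OF inj_ivp_seq]) auto

lemma sl_is_eig_iff_sl_mult:
  assumes "\<forall>n\<le>N. f n \<noteq> 0"
  shows "sl_is_eig f q w N bc x \<longleftrightarrow> sl_mult f q w N bc x \<noteq> 0"
proof -
  let ?T = "boundary_matrix f q w N bc x"
  have zero: "ivp_seq f q w N x v = 0 \<longleftrightarrow> v = 0" for v
    using inj_ivp_seq[of f, THEN injD, of q w N x v 0] assms
      vec_seq.linear_0[OF linear_ivp_seq, of f q w N x] by auto
  have "sl_is_eig f q w N bc x \<longleftrightarrow> \<not> {v. ?T *v v = 0} \<subseteq> {0}"
    unfolding sl_is_eig_def sl_sol_space_eq_ivp_seq[OF assms] using zero by auto
  also have "\<dots> \<longleftrightarrow> sl_mult f q w N bc x \<noteq> 0"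
    unfolding vec.dim_eq_0[symmetric] dim_kernel_2 sl_mult_eq[OF assms] by simp
  finally show ?thesis .
qed

lemma less_card_le_iff:
  fixes \<mu> :: "nat \<Rightarrow> 'a::linorder"
  assumes mono: "mono_on {..<n} \<mu>" and j: "j < n"
  shows "j < card {i. i < n \<and> \<mu> i \<le> x} \<longleftrightarrow> \<mu> j \<le> x"
proof
  assume "\<mu> j \<le> x"
  then have "{..j} \<subseteq> {i. i < n \<and> \<mu> i \<le> x}"
    using mono_onD[OF mono, of _ j] j by (auto intro: order.trans)
  then have "card {..j} \<le> card {i. i < n \<and> \<mu> i \<le> x}" by (intro card_mono) auto
  then show "j < card {i. i < n \<and> \<mu> i \<le> x}" by simp
next
  assume less: "j < card {i. i < n \<and> \<mu> i \<le> x}"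
  show "\<mu> j \<le> x"
  proof (rule ccontr)
    assume "\<not> \<mu> j \<le> x"
    then have "{i. i < n \<and> \<mu> i \<le> x} \<subseteq> {..<j}"
      using mono_onD[OF mono, of j] j by (force simp: not_less[symmetric])
    then have "card {i. i < n \<and> \<mu> i \<le> x} \<le> card {..<j}" by (intro card_mono) auto
    then show False using less by simp
  qed
qed

lemma sl_eig_eqI:
  assumes f: "\<forall>n\<le>N. f n \<noteq> 0"
    and mono: "mono_on {..<n} \<mu>"
    and mult: "\<And>x. sl_mult f q w N bc (complex_of_real x) = count (image_mset \<mu> (mset_set {..<n})) x"
    and j: "j < n"
  shows "sl_eig f q w N bc j = \<mu> j"
proof -
  define A where "A = image_mset \<mu> (mset_set {..<n})"
  have "sl_count f q w N bc x = card {i. i < n \<and> \<mu> i \<le> x}" for x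
  proof -
    have "sl_count f q w N bc x = (\<Sum>y\<in>set_mset {#y \<in># A. y \<le> x#}. count A y)"
      unfolding sl_count_def sl_is_eig_iff_sl_mult[OF f] mult A_def[symmetric]
      by (intro sum.cong) auto
    also have "\<dots> = size {#y \<in># A. y \<le> x#}"
      unfolding size_multiset_overloaded_eq by (intro sum.cong) auto
    also have "\<dots> = card {i. i < n \<and> \<mu> i \<le> x}"
      by (simp add: A_def filter_mset_image_mset)
    finally show ?thesis .
  qed
  then have "{x. j < sl_count f q w N bc x} = {\<mu> j..}"
    using less_card_le_iff[OF mono j] by auto
  then show ?thesis by (simp add: sl_eig_def)
qed

section \<open>Zeros and leading coefficients\<close>

locale sl_problem =
  fixes N :: nat and f q w :: "nat \<Rightarrow> real"
  assumes N_ge_2: "2 \<le> N"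
    and f_nonzero: "\<forall>n\<le>N. f n \<noteq> 0"
    and w_pos: "\<forall>n\<in>{1..N}. 0 < w n"
begin

abbreviation "sol \<equiv> ivp_sol f q w"
abbreviation "quasi \<equiv> ivp_quasi f q w"

lemma f_0_1_nonzero: "f 0 \<noteq> 0" "f 1 \<noteq> 0"
  using f_nonzero N_ge_2 by auto

lemma weighted_norm_pos:
  fixes a b z :: "'a::real_normed_field"
  assumes "(a, b) \<noteq> (0, 0)"
  defines "u \<equiv> ivp_sol (\<lambda>n. of_real (f n)) (\<lambda>n. of_real (q n)) (\<lambda>n. of_real (w n)) a b"
  shows "0 < (\<Sum>k=1..N. w k * (norm (poly (u k) z))\<^sup>2)"
proof -
  have "\<exists>k\<in>{1..N}. poly (u k) z \<noteq> 0"
    unfolding u_def using assms(1) f_0_1_nonzero N_ge_2 by (intro ivp_sol_nontrivial) simp_all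
  then obtain k where "k \<in> {1..N}" "poly (u k) z \<noteq> 0" by blast
  then show ?thesis
    using w_pos by (intro sum_pos2[of _ k]) (auto simp: order.strict_implies_order)
qed

lemma weighted_square_pos:
  "(a, b) \<noteq> (0, 0) \<Longrightarrow> 0 < (\<Sum>k=1..N. w k * (poly (sol a b k) x)\<^sup>2)"
  using weighted_norm_pos[of a b x] by simp

lemma card_roots_quasi:
  assumes ab: "(a, b) \<noteq> (0, 0)"
  shows "card {x. poly (quasi a b N) x = 0} = degree (quasi a b N)"
proof (rule card_roots_eq_degree)
  fix z assume root: "poly (map_poly complex_of_real (quasi a b N)) z = 0"
  let ?u = "\<lambda>k. ivp_sol (cseq f) (cseq q) (cseq w) (of_real a) (of_real b) k"
  have cnj: "poly (map_poly of_real p) (cnj z) = cnj (poly (map_poly of_real p) z)" for p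
    by (rule poly_cnj_real[symmetric]) (simp add: coeff_map_poly)
  have "(z - cnj z) * (\<Sum>k=1..N. of_real (w k) * (poly (?u k) z * poly (?u k) (cnj z))) = 0"
    using green_identity[of "cseq f" "cseq q" "cseq w" "of_real a" "of_real b" N z
        "of_real a" "of_real b" "cnj z"] root by (simp add: ivp_quasi_of_real cnj)
  also have "(\<Sum>k=1..N. of_real (w k) * (poly (?u k) z * poly (?u k) (cnj z))) =
      of_real (\<Sum>k=1..N. w k * (cmod (poly (?u k) z))\<^sup>2)"
    by (simp add: ivp_sol_of_real cnj complex_norm_square del: of_real_power)
  finally have "z = cnj z"
    using weighted_norm_pos[of "complex_of_real a" "of_real b" z] ab by (simp del: of_real_sum)
  then show "z \<in> \<real>" by (simp add: Reals_cnj_iff)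
next
  fix x assume "poly (quasi a b N) x = 0"
  then have "0 < - (poly (sol a b N) x * poly (pderiv (quasi a b N)) x)"
    using lagrange_identity[of f q w a b N x a b] weighted_square_pos[OF ab, of x]
    by (simp add: power2_eq_square)
  then show "poly (pderiv (quasi a b N)) x \<noteq> 0" by auto
qed

definition lead_const :: real where
  "lead_const = (\<Prod>k=1..N. w k) * (\<Prod>i=0..N-1. 1 / f i)"

lemma lead_const_pos:
  assumes "(\<Prod>i=0..N-1. 1 / f i) > 0"
  shows "0 < lead_const"
  unfolding lead_const_def by (rule mult_pos_pos[OF prod_pos assms]) (use w_pos in auto)

lemma degree_sol_le: "degree (sol a b N) \<le> N - 1"
  and degree_quasi_le: "degree (quasi a b N) \<le> N"
  and coeff_quasi: "coeff (quasi a b N) N = (-1) ^ N * lead_const * (f 0 * a + b)"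
proof -
  have first: "sol a b (Suc 0) = [:a + b / f 0:]" "quasi a b 0 = [:b:]"
    by (simp_all add: ivp_sol_Suc)
  show "degree (sol a b N) \<le> N - 1" "degree (quasi a b N) \<le> N"
    using degree_ivp_sol_from[OF first, of "N - 1"] degree_ivp_quasi_from[OF first, of "N - 1"] N_ge_2
    by simp_all
  have "(\<Prod>k=1..N. - w k) = (-1) ^ N * (\<Prod>k=1..N. w k)"
    using prod.distrib[of "\<lambda>_. -1" w "{1..N}"] by simp
  moreover have "(\<Prod>i=0..N-1. 1 / f i) = 1 / f 0 * (\<Prod>i=1..N-1. 1 / f i)"
    using prod.atLeast_Suc_atMost[of 0 "N - 1" "\<lambda>i. 1 / f i"] by simp
  moreover have "a + b / f 0 = (f 0 * a + b) / f 0"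
    using f_0_1_nonzero by (simp add: field_simps)
  ultimately show "coeff (quasi a b N) N = (-1) ^ N * lead_const * (f 0 * a + b)"
    using coeff_ivp_quasi_from[OF first, of "N - 1"] N_ge_2 by (simp add: lead_const_def)
qed

lemma degree_quasi_exceptional_le:
    "f 0 * a + b = 0 \<Longrightarrow> degree (quasi a b N) \<le> N - 1"
  and coeff_quasi_exceptional:
    "f 0 * a + b = 0 \<Longrightarrow> coeff (quasi a b N) (N - 1) = (-1) ^ N * lead_const * ((f 0)\<^sup>2 / w 1 * a)"
proof -
  assume ab: "f 0 * a + b = 0"
  have Suc_N: "1 + (N - 2) = N - 1" "Suc (N - 1) = N" "Suc (N - 2) = N - 1" "Suc 1 = 2"
    using N_ge_2 by auto
  have b: "b = - f 0 * a" and "a + b / f 0 = 0"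
    using ab f_0_1_nonzero by (simp_all add: field_simps)
  then have second: "sol a b (Suc 1) = [:b / f 1:]" "quasi a b 1 = [:b:]"
    by (simp_all add: ivp_sol_Suc ivp_quasi_Suc)
  show "degree (quasi a b N) \<le> N - 1"
    using degree_ivp_quasi_from[OF second, of "N - 2"] unfolding Suc_N .
  have "(\<Prod>k=1..N. w k) = w 1 * (\<Prod>k=2..N. w k)"
    using prod.atLeast_Suc_atMost[of 1 N w] N_ge_2 by (simp add: numeral_2_eq_2)
  moreover have "(\<Prod>k=2..N. - w k) = (-1) ^ (N - 1) * (\<Prod>k=2..N. w k)"
    using prod.distrib[of "\<lambda>_. -1" w "{2..N}"] N_ge_2 by simp
  moreover have "(\<Prod>i=0..N-1. 1 / f i) = 1 / f 0 * (1 / f 1 * (\<Prod>i=2..N-1. 1 / f i))"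
    using prod.atLeast_Suc_atMost[of 0 "N - 1" "\<lambda>i. 1 / f i"]
      prod.atLeast_Suc_atMost[of 1 "N - 1" "\<lambda>i. 1 / f i"] N_ge_2 by (simp add: numeral_2_eq_2)
  moreover have "(-1::real) ^ N = - ((-1) ^ (N - 1))" using N_ge_2 by (cases N) auto
  moreover have "w 1 > 0" using w_pos N_ge_2 by simp
  ultimately show "coeff (quasi a b N) (N - 1) = (-1) ^ N * lead_const * ((f 0)\<^sup>2 / w 1 * a)"
    using coeff_ivp_quasi_from[OF second, of "N - 2", unfolded Suc_N] f_0_1_nonzero
    by (simp add: lead_const_def b power2_eq_square)
qed

end

section \<open>The discriminant\<close>

lemma matrix_mult_eq_0_iff:
  fixes A :: "'a::field^'n^'n"
  assumes "det A \<noteq> 0"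
  shows "A ** B = 0 \<longleftrightarrow> B = 0"
proof
  have zero: "C ** 0 = 0" for C :: "'a^'n^'n" by (simp add: matrix_matrix_mult_def vec_eq_iff)
  assume "A ** B = 0"
  moreover obtain A' where "A' ** A = mat 1"
    using assms invertible_det_nz[of A] unfolding invertible_def by blast
  ultimately show "B = 0"
    using matrix_mul_assoc[of A' A B] zero[of A'] by simp
qed (simp add: matrix_matrix_mult_def vec_eq_iff)

lemma cmat_mult: "cmat (A ** B) = cmat A ** cmat B"
  by (simp add: cmat_def vec_eq_iff matrix_matrix_mult_def sum_2)

lemma transfer_matrix_of_real:
  "transfer_matrix (cseq f) (cseq q) (cseq w) n (of_real x) = cmat (transfer_matrix f q w n x)"
  using ivp_sol_of_real[where 'a = complex, of f q w 1 0 n]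
    ivp_sol_of_real[where 'a = complex, of f q w 0 1 n]
    ivp_quasi_of_real[where 'a = complex, of f q w 1 0 n]
    ivp_quasi_of_real[where 'a = complex, of f q w 0 1 n]
  by (simp add: transfer_matrix_def cmat_def vec_eq_iff forall_2 poly_map_poly_of_real)

locale sl_coupled = sl_problem +
  fixes M :: "real^2^2"
  assumes det_M: "det M = 1"
begin

definition discr :: "real poly" where
  "discr = smult (M$2$2) (sol 1 0 N) - smult (M$1$2) (quasi 1 0 N)
         - smult (M$2$1) (sol 0 1 N) + smult (M$1$1) (quasi 0 1 N)"

definition floquet :: "real \<Rightarrow> real^2^2" where
  "floquet x = vector [vector [M$2$2, - M$1$2], vector [- M$2$1, M$1$1]] ** transfer_matrix f q w N x"

lemma floquet_entries:
  "floquet x $ 1 $ 1 = M$2$2 * poly (sol 1 0 N) x - M$1$2 * poly (quasi 1 0 N) x"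
  "floquet x $ 1 $ 2 = M$2$2 * poly (sol 0 1 N) x - M$1$2 * poly (quasi 0 1 N) x"
  "floquet x $ 2 $ 1 = M$1$1 * poly (quasi 1 0 N) x - M$2$1 * poly (sol 1 0 N) x"
  "floquet x $ 2 $ 2 = M$1$1 * poly (quasi 0 1 N) x - M$2$1 * poly (sol 0 1 N) x"
  by (simp_all add: floquet_def transfer_matrix_def matrix_matrix_mult_def sum_2)

lemma mult_floquet: "M ** floquet x = transfer_matrix f q w N x"
proof -
  have "M ** vector [vector [M$2$2, - M$1$2], vector [- M$2$1, M$1$1]] = mat 1"
    using det_M
    by (simp add: det_2 vec_eq_iff forall_2 matrix_matrix_mult_def sum_2 mat_def algebra_simps)
  then show ?thesis by (simp add: floquet_def matrix_mul_assoc)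
qed

lemma det_floquet: "det (floquet x) = 1"
  using arg_cong[OF mult_floquet[of x], of det] by (simp add: det_mul det_M det_transfer_matrix)

lemma poly_discr: "poly discr x = floquet x $ 1 $ 1 + floquet x $ 2 $ 2"
  by (simp add: discr_def floquet_entries)

lemma wronskian:
  "poly (sol 1 0 N) x * poly (quasi 0 1 N) x - poly (sol 0 1 N) x * poly (quasi 1 0 N) x = 1"
  using det_transfer_matrix[of f q w N x] by (simp add: transfer_matrix_def det_2)

text \<open>With \<open>F = floquet x\<close>, the initial data \<open>(- F\<^sub>1\<^sub>2, F\<^sub>1\<^sub>1)\<close> and \<open>(F\<^sub>2\<^sub>2, - F\<^sub>2\<^sub>1)\<close> are carried to the
  columns of \<open>M\<close> at \<open>N\<close>; the Lagrange identity with these data gives \<open>D'\<close>.\<close>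

lemma poly_pderiv_discr:
  "poly (pderiv discr) x = (\<Sum>k=1..N. w k *
     (- floquet x $ 1 $ 2 * (poly (sol 1 0 k) x)\<^sup>2
      + (floquet x $ 1 $ 1 - floquet x $ 2 $ 2) * (poly (sol 1 0 k) x * poly (sol 0 1 k) x)
      + floquet x $ 2 $ 1 * (poly (sol 0 1 k) x)\<^sup>2))"
proof -
  let ?F = "floquet x"
  have col_2: "poly (sol (- ?F $ 1 $ 2) (?F $ 1 $ 1) N) x = M$1$2"
      "poly (quasi (- ?F $ 1 $ 2) (?F $ 1 $ 1) N) x = M$2$2"
    and col_1: "poly (sol (?F $ 2 $ 2) (- ?F $ 2 $ 1) N) x = M$1$1"
      "poly (quasi (?F $ 2 $ 2) (- ?F $ 2 $ 1) N) x = M$2$1"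
    unfolding ivp_superposition[of f q w "- ?F $ 1 $ 2"] ivp_superposition[of f q w "?F $ 2 $ 2"]
    unfolding floquet_entries
    using wronskian[of x] by algebra+
  have "poly (pderiv discr) x =
      (poly (pderiv (sol 1 0 N)) x * M$2$2 - M$1$2 * poly (pderiv (quasi 1 0 N)) x)
      - (poly (pderiv (sol 0 1 N)) x * M$2$1 - M$1$1 * poly (pderiv (quasi 0 1 N)) x)"
    by (simp add: discr_def pderiv_add pderiv_diff pderiv_smult algebra_simps)
  also have "\<dots> = (\<Sum>k=1..N. w k * (poly (sol 1 0 k) x * poly (sol (- ?F $ 1 $ 2) (?F $ 1 $ 1) k) x))
      - (\<Sum>k=1..N. w k * (poly (sol 0 1 k) x * poly (sol (?F $ 2 $ 2) (- ?F $ 2 $ 1) k) x))"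
    using lagrange_identity[of f q w 1 0 N x "- ?F $ 1 $ 2" "?F $ 1 $ 1"]
      lagrange_identity[of f q w 0 1 N x "?F $ 2 $ 2" "- ?F $ 2 $ 1"]
    unfolding col_1 col_2 by simp
  also have "\<dots> = (\<Sum>k=1..N. w k *
     (- ?F $ 1 $ 2 * (poly (sol 1 0 k) x)\<^sup>2
      + (?F $ 1 $ 1 - ?F $ 2 $ 2) * (poly (sol 1 0 k) x * poly (sol 0 1 k) x)
      + ?F $ 2 $ 1 * (poly (sol 0 1 k) x)\<^sup>2))"
    unfolding sum_subtractf[symmetric]
      ivp_superposition[of f q w "- ?F $ 1 $ 2"] ivp_superposition[of f q w "?F $ 2 $ 2"]
    by (intro sum.cong refl) (simp add: power2_eq_square algebra_simps)
  finally show ?thesis .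
qed

lemma discr_squared:
  "(poly discr x)\<^sup>2 - 4 =
     (floquet x $ 1 $ 1 - floquet x $ 2 $ 2)\<^sup>2 + 4 * floquet x $ 1 $ 2 * floquet x $ 2 $ 1"
  using det_floquet[of x] unfolding poly_discr det_2 by algebra

text \<open>Completing the square in \<open>poly_pderiv_discr\<close>, whose form has discriminant \<open>D\<^sup>2 - 4\<close>.\<close>

lemma pderiv_discr_nonzero:
  assumes D: "\<bar>poly discr x\<bar> \<le> 2" and F12: "floquet x $ 1 $ 2 \<noteq> 0"
  shows "poly (pderiv discr) x \<noteq> 0"
proof -
  let ?F = "floquet x" and ?s = "sol (2 * floquet x $ 1 $ 2) (floquet x $ 2 $ 2 - floquet x $ 1 $ 1)"
  have "- 4 * ?F $ 1 $ 2 * poly (pderiv discr) x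
      = (\<Sum>k=1..N. w k * (poly (?s k) x)\<^sup>2 + (4 - (poly discr x)\<^sup>2) * (w k * (poly (sol 0 1 k) x)\<^sup>2))"
    unfolding poly_pderiv_discr sum_distrib_left
  proof (intro sum.cong refl)
    fix k
    show "- 4 * ?F $ 1 $ 2 * (w k * (- ?F $ 1 $ 2 * (poly (sol 1 0 k) x)\<^sup>2
        + (?F $ 1 $ 1 - ?F $ 2 $ 2) * (poly (sol 1 0 k) x * poly (sol 0 1 k) x)
        + ?F $ 2 $ 1 * (poly (sol 0 1 k) x)\<^sup>2))
      = w k * (poly (?s k) x)\<^sup>2 + (4 - (poly discr x)\<^sup>2) * (w k * (poly (sol 0 1 k) x)\<^sup>2)"
      unfolding ivp_superposition[of f q w "2 * ?F $ 1 $ 2"] using discr_squared[of x] by algebra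
  qed
  also have "\<dots> = (\<Sum>k=1..N. w k * (poly (?s k) x)\<^sup>2)
      + (4 - (poly discr x)\<^sup>2) * (\<Sum>k=1..N. w k * (poly (sol 0 1 k) x)\<^sup>2)"
    by (simp add: sum.distrib sum_distrib_left)
  also have "\<dots> > 0"
    using weighted_square_pos[of "2 * ?F $ 1 $ 2"] weighted_square_pos[of 0 1 x] F12
      power_mono[OF D, of 2]
    by (intro add_pos_nonneg mult_nonneg_nonneg) auto
  finally show ?thesis by auto
qed

lemma pderiv_discr_eq_0_iff:
  assumes D: "\<bar>poly discr x\<bar> \<le> 2"
  shows "poly (pderiv discr) x = 0 \<longleftrightarrow>
    floquet x $ 1 $ 2 = 0 \<and> floquet x $ 2 $ 1 = 0 \<and> floquet x $ 1 $ 1 = floquet x $ 2 $ 2"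
proof
  assume D': "poly (pderiv discr) x = 0"
  then have F12: "floquet x $ 1 $ 2 = 0" using pderiv_discr_nonzero[OF D] by blast
  then have "(poly discr x)\<^sup>2 - 4 = (floquet x $ 1 $ 1 - floquet x $ 2 $ 2)\<^sup>2"
    using discr_squared[of x] by simp
  moreover have "(poly discr x)\<^sup>2 \<le> 4" using power_mono[OF D, of 2] by simp
  ultimately have "(floquet x $ 1 $ 1 - floquet x $ 2 $ 2)\<^sup>2 \<le> 0" by linarith
  then have diag: "floquet x $ 1 $ 1 = floquet x $ 2 $ 2" by simp
  have "floquet x $ 2 $ 1 * (\<Sum>k=1..N. w k * (poly (sol 0 1 k) x)\<^sup>2) = 0"
    using D' by (simp add: poly_pderiv_discr F12 diag sum_distrib_left mult.left_commute)
  then show "floquet x $ 1 $ 2 = 0 \<and> floquet x $ 2 $ 1 = 0 \<and> floquet x $ 1 $ 1 = floquet x $ 2 $ 2"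
    using weighted_square_pos[of 0 1 x] F12 diag by simp
qed (simp add: poly_pderiv_discr)

definition floquet_bc :: "real \<Rightarrow> bcond" where
  "floquet_bc \<gamma> = bc_coupled (\<chi> i j. exp (\<i> * complex_of_real \<gamma>) * cmat M $ i $ j)"

lemma boundary_matrix_floquet_bc:
  "boundary_matrix f q w N (floquet_bc \<gamma>) (of_real x) = cmat M ** (mat (cis \<gamma>) - cmat (floquet x))"
proof -
  have "(\<chi> i j. exp (\<i> * complex_of_real \<gamma>) * cmat M $ i $ j) = cmat M ** mat (cis \<gamma>)"
    by (simp add: vec_eq_iff matrix_matrix_mult_def sum_2 forall_2 mat_def cis_conv_exp)
  then have "boundary_matrix f q w N (floquet_bc \<gamma>) (of_real x) =
      cmat M ** mat (cis \<gamma>) + - mat 1 ** (cmat M ** cmat (floquet x))"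
    by (simp add: boundary_matrix_def floquet_bc_def bc_coupled_def transfer_matrix_of_real
        flip: mult_floquet cmat_mult)
  also have "\<dots> = cmat M ** (mat (cis \<gamma>) - cmat (floquet x))"
    by (simp add: vec_eq_iff forall_2 matrix_matrix_mult_def sum_2 mat_def algebra_simps)
  finally show ?thesis .
qed

lemma det_cmat: "det (cmat A) = of_real (det A)"
  by (simp add: det_2 cmat_def)

lemma det_boundary_matrix_floquet_bc:
  "det (boundary_matrix f q w N (floquet_bc \<gamma>) (of_real x)) =
     cis \<gamma> * of_real (2 * cos \<gamma> - poly discr x)"
proof -
  have "(cis \<gamma>)\<^sup>2 + 1 = of_real (2 * cos \<gamma>) * cis \<gamma>"
    using sin_squared_eq[of \<gamma>] by (simp add: complex_eq_iff power2_eq_square)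
  moreover have "det (mat (cis \<gamma>) - cmat (floquet x)) =
      (cis \<gamma>)\<^sup>2 - cis \<gamma> * of_real (poly discr x) + of_real (det (floquet x))"
    unfolding poly_discr by (simp add: det_2 cmat_def mat_def algebra_simps power2_eq_square)
  ultimately show ?thesis
    by (simp add: boundary_matrix_floquet_bc det_mul det_cmat det_M det_floquet algebra_simps)
qed

lemma boundary_matrix_floquet_bc_eq_0_iff:
  assumes D: "poly discr x = 2 * cos \<gamma>"
  shows "boundary_matrix f q w N (floquet_bc \<gamma>) (of_real x) = 0 \<longleftrightarrow> poly (pderiv discr) x = 0"
proof -
  let ?F = "floquet x"
  have "\<bar>poly discr x\<bar> \<le> 2" unfolding D using abs_cos_le_one[of \<gamma>] by linarith
  note pderiv_iff = pderiv_discr_eq_0_iff[OF this]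
  have "cmat M ** (mat (cis \<gamma>) - cmat ?F) = 0 \<longleftrightarrow> cmat ?F = mat (cis \<gamma>)"
    by (subst matrix_mult_eq_0_iff) (auto simp: det_cmat det_M)
  also have "\<dots> \<longleftrightarrow> poly (pderiv discr) x = 0"
  proof
    assume "cmat ?F = mat (cis \<gamma>)"
    then show "poly (pderiv discr) x = 0"
      unfolding pderiv_iff by (auto simp: vec_eq_iff forall_2 cmat_def mat_def) (metis of_real_eq_iff)
  next
    assume "poly (pderiv discr) x = 0"
    then have scalar: "?F $ 1 $ 2 = 0" "?F $ 2 $ 1 = 0" "?F $ 1 $ 1 = cos \<gamma>" "?F $ 2 $ 2 = cos \<gamma>"
      using D unfolding pderiv_iff poly_discr by simp_all
    then have "(cos \<gamma>)\<^sup>2 = 1"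
      using det_floquet[of x] by (simp add: det_2 power2_eq_square)
    then have "sin \<gamma> = 0" by (simp add: cos_squared_eq)
    then show "cmat ?F = mat (cis \<gamma>)"
      using scalar by (simp add: vec_eq_iff forall_2 cmat_def mat_def complex_eq_iff)
  qed
  finally show ?thesis unfolding boundary_matrix_floquet_bc .
qed

lemma sl_mult_floquet_bc:
  "sl_mult f q w N (floquet_bc \<gamma>) (of_real x) =
     (if poly discr x \<noteq> 2 * cos \<gamma> then 0 else if poly (pderiv discr) x = 0 then 2 else 1)"
proof -
  have "det (boundary_matrix f q w N (floquet_bc \<gamma>) (of_real x)) = 0 \<longleftrightarrow> 2 * cos \<gamma> - poly discr x = 0"
    unfolding det_boundary_matrix_floquet_bc
    by (simp only: mult_eq_0_iff of_real_eq_0_iff cis_neq_zero) simp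
  then show ?thesis
    unfolding sl_mult_eq[OF f_nonzero] using boundary_matrix_floquet_bc_eq_0_iff by auto
qed

definition sep_poly :: "real poly" where
  "sep_poly = quasi (M$2$2) (- M$2$1) N"

lemma row_2_nonzero: "(M$2$2, - M$2$1) \<noteq> (0, 0)"
  using det_M by (auto simp: det_2)

lemma sl_mult_bc_V:
  "sl_mult f q w N (bc_V M) (of_real x) = (if poly sep_poly x = 0 then 1 else 0)"
proof -
  let ?T = "boundary_matrix f q w N (bc_V M) (of_real x)"
  have T: "?T = cmat (vector [vector [M$2$1, M$2$2],
      vector [poly (quasi 1 0 N) x, poly (quasi 0 1 N) x]])"
    unfolding boundary_matrix_def bc_V_def transfer_matrix_of_real
    by (simp add: cmat_def transfer_matrix_def vec_eq_iff forall_2 matrix_matrix_mult_def sum_2)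
  have "det ?T = - of_real (poly sep_poly x)"
    unfolding T sep_poly_def poly_ivp_quasi_superposition[of f q w "M$2$2"]
    by (simp add: det_2 cmat_def)
  moreover have "?T \<noteq> 0"
    using row_2_nonzero by (simp add: T cmat_def vec_eq_iff forall_2)
  ultimately show ?thesis
    unfolding sl_mult_eq[OF f_nonzero] by simp
qed

text \<open>At a zero of \<open>sep_poly\<close> the vector \<open>(M$2$2, - M$2$1)\<close> is an eigenvector of \<open>floquet x\<close>;
  its eigenvalue \<open>s\<close> is the value of the solution at \<open>N\<close>, so that \<open>D = s + 1 / s\<close>.\<close>

lemma discr_at_sep_root:
  assumes root: "poly sep_poly x = 0"
  shows "2 \<le> \<bar>poly discr x\<bar>" "poly discr x * poly (pderiv sep_poly) x < 0"
proof -
  define s where "s = poly (sol (M$2$2) (- M$2$1) N) x"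
  have eigenvalue: "poly discr x * s = s\<^sup>2 + 1"
    using root wronskian[of x] det_M
    unfolding s_def sep_poly_def ivp_superposition[of f q w "M$2$2"] poly_discr floquet_entries det_2
    by algebra
  then have pos: "0 < poly discr x * s" by (simp add: add_nonneg_pos)
  have "2 * \<bar>s\<bar> \<le> s\<^sup>2 + 1"
    using zero_le_power2[of "\<bar>s\<bar> - 1"] by (simp add: power2_diff)
  also have "\<dots> = \<bar>poly discr x\<bar> * \<bar>s\<bar>"
    using eigenvalue pos by (simp flip: abs_mult)
  finally show "2 \<le> \<bar>poly discr x\<bar>"
    using pos by (auto simp: mult_le_cancel_right)
  have "0 < - s * poly (pderiv sep_poly) x"
    using lagrange_identity[of f q w "M$2$2" "- M$2$1" N x "M$2$2" "- M$2$1"]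
      weighted_square_pos[OF row_2_nonzero, of x] root
    by (simp add: sep_poly_def s_def power2_eq_square)
  then show "poly discr x * poly (pderiv sep_poly) x < 0"
    using pos by (auto simp: mult_less_0_iff zero_less_mult_iff)
qed

end

section \<open>Interlacing\<close>

lemma abs_cos_less_1:
  assumes "- pi < \<gamma>" "\<gamma> < pi" "\<gamma> \<noteq> 0"
  shows "\<bar>cos \<gamma>\<bar> < 1"
proof -
  have "cos pi < cos \<bar>\<gamma>\<bar>" "cos \<bar>\<gamma>\<bar> < cos 0" using assms by (intro cos_monotone_0_pi; simp)+
  then show ?thesis by (simp add: abs_less_iff)
qed

lemma sl_eig_bc_V_uminus: "sl_eig f q w N (bc_V (- K)) = sl_eig f q w N (bc_V K)"
proof -
  have "sl_sol_space f q w N (bc_V (- K)) x = sl_sol_space f q w N (bc_V K) x" for x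
    by (simp add: sl_sol_space_def bc_V_def vec_eq_iff forall_2 matrix_vector_mult_def sum_2 cmat_def
        neg_eq_iff_add_eq_0)
  then show ?thesis
    unfolding sl_eig_def sl_count_def sl_is_eig_def sl_mult_def by simp
qed

context sl_coupled
begin

lemma floquet_bc_0: "floquet_bc 0 = bc_coupled (cmat M)"
  by (simp add: floquet_bc_def vec_eq_iff)

lemma floquet_bc_pi: "floquet_bc pi = bc_coupled (cmat (- M))"
  by (simp add: floquet_bc_def vec_eq_iff cmat_def mult.commute[of \<i>])

context
  fixes \<alpha> \<beta> :: "nat \<Rightarrow> real"
  assumes bands: "poly_bands discr 2 N \<alpha> \<beta>" and degree_discr: "degree discr = N"
begin

interpretation poly_bands discr 2 N \<alpha> \<beta> by (rule bands)

lemma sl_eig_floquet_bc: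
  assumes \<mu>: "\<And>j. j < N \<Longrightarrow> \<alpha> j \<le> \<mu> j \<and> \<mu> j \<le> \<beta> j" "\<And>j. j < N \<Longrightarrow> poly discr (\<mu> j) = 2 * cos \<gamma>"
    and j: "j < N"
  shows "sl_eig f q w N (floquet_bc \<gamma>) j = \<mu> j"
proof (rule sl_eig_eqI[OF f_nonzero mono_on_band_points[OF \<mu>] _ j])
  fix x
  define p where "p = discr - [:2 * cos \<gamma>:]"
  have "0 < degree discr" using degree_discr N_ge_2 by simp
  then have "p \<noteq> 0" by (auto simp: p_def)
  have "proots p = image_mset \<mu> (mset_set {..<N})"
    unfolding p_def using proots_band_points[OF \<mu> degree_discr] N_ge_2 by simp
  then have count: "count (image_mset \<mu> (mset_set {..<N})) x = order x p"
    using \<open>p \<noteq> 0\<close> by (simp flip: count_proots)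
  then have "order x p \<le> 2" using count_band_points_le[OF \<mu>, of x] by simp
  show "sl_mult f q w N (floquet_bc \<gamma>) (of_real x) = count (image_mset \<mu> (mset_set {..<N})) x"
  proof (cases "poly p x = 0")
    case True
    have "2 \<le> order x p \<longleftrightarrow> poly (pderiv discr) x = 0"
      using two_le_order_iff[OF \<open>p \<noteq> 0\<close> True] by (simp add: p_def pderiv_diff pderiv_pCons)
    moreover have "order x p \<noteq> 0" using True \<open>p \<noteq> 0\<close> by (simp add: order_root)
    ultimately have "order x p = (if poly (pderiv discr) x = 0 then 2 else 1)"
      using \<open>order x p \<le> 2\<close> by auto
    then show ?thesis
      using True unfolding count sl_mult_floquet_bc by (simp add: p_def)
  next
    case False
    then show ?thesis
      unfolding count sl_mult_floquet_bc by (simp add: p_def order_0I)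
  qed
qed

lemma sl_eig_coupled:
  assumes "j < N"
  shows "sl_eig f q w N (bc_coupled (cmat M)) j = (if even j then \<alpha> j else \<beta> j)"
    and "sl_eig f q w N (bc_coupled (cmat (- M))) j = (if even j then \<beta> j else \<alpha> j)"
proof -
  show "sl_eig f q w N (bc_coupled (cmat M)) j = (if even j then \<alpha> j else \<beta> j)"
    unfolding floquet_bc_0[symmetric]
    by (rule sl_eig_floquet_bc) (use assms nontrivial left_end right_end in \<open>auto intro: less_imp_le\<close>)
  show "sl_eig f q w N (bc_coupled (cmat (- M))) j = (if even j then \<beta> j else \<alpha> j)"
    unfolding floquet_bc_pi[symmetric]
    by (rule sl_eig_floquet_bc) (use assms nontrivial left_end right_end in \<open>auto intro: less_imp_le\<close>)
qed

lemma sl_eig_floquet_bc_strictly_inside: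
  assumes "- pi < \<gamma>" "\<gamma> < pi" "\<gamma> \<noteq> 0" and j: "j < N"
  shows "\<alpha> j < sl_eig f q w N (floquet_bc \<gamma>) j \<and> sl_eig f q w N (floquet_bc \<gamma>) j < \<beta> j"
proof -
  have cos: "\<bar>2 * cos \<gamma>\<bar> < 2" using abs_cos_less_1[OF assms(1-3)] by simp
  then obtain \<mu> where \<mu>: "\<And>j. j < N \<Longrightarrow> \<alpha> j \<le> \<mu> j \<and> \<mu> j \<le> \<beta> j \<and> poly discr (\<mu> j) = 2 * cos \<gamma>"
    using value_in_band[of "2 * cos \<gamma>"] by (metis less_imp_le)
  have "\<bar>poly discr (\<alpha> j)\<bar> = 2" "\<bar>poly discr (\<beta> j)\<bar> = 2"
    using left_end[OF j] right_end[OF j] by (simp_all add: abs_mult power_abs)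
  then have "\<alpha> j \<noteq> \<mu> j" "\<mu> j \<noteq> \<beta> j" using \<mu>[OF j] cos by auto
  then show ?thesis using \<mu> j sl_eig_floquet_bc[of \<mu> \<gamma> j] by force
qed

end

text \<open>The \<open>j\<close>-th zero of \<open>sep_poly\<close> lies between the bands with indices \<open>j + sep_offset - 1\<close> and
  \<open>j + sep_offset\<close>. If \<open>f\<^sub>0 M\<^sub>2\<^sub>2 = M\<^sub>2\<^sub>1\<close>, one zero has escaped to \<open>+\<infinity>\<close>.\<close>

definition sep_degree :: nat where
  "sep_degree = (if f 0 * M$2$2 = M$2$1 then N - 1 else N)"

definition sep_offset :: nat where
  "sep_offset = (if M$2$1 < f 0 * M$2$2 then 0 else 1)"

context
  assumes prod_inverse_pos: "(\<Prod>i=0..N-1. 1 / f i) > 0"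
    and lead_pos: "M$1$1 - f 0 * M$1$2 > 0"
begin

lemma degree_discr: "degree discr = N"
  and lead_coeff_discr_sign: "0 < (-1) ^ N * lead_coeff discr"
proof -
  have "coeff (sol a b N) N = 0" for a b
    using degree_sol_le[of a b] N_ge_2 by (intro coeff_eq_0) simp
  then have coeff: "coeff discr N = (-1) ^ N * lead_const * (M$1$1 - f 0 * M$1$2)"
    by (simp add: discr_def coeff_quasi algebra_simps)
  then have sign: "0 < (-1) ^ N * coeff discr N"
    using lead_const_pos[OF prod_inverse_pos] lead_pos by (simp flip: mult.assoc power_add)
  have "degree discr \<le> N"
    unfolding discr_def using degree_sol_le[of 1 0] degree_sol_le[of 0 1] degree_quasi_le N_ge_2
    by (intro degree_add_le degree_diff_le order.trans[OF degree_smult_le]) auto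
  then show "degree discr = N" using sign by (intro antisym le_degree) auto
  then show "0 < (-1) ^ N * lead_coeff discr" using sign by simp
qed

lemma degree_sep_poly: "degree sep_poly = sep_degree"
  and lead_coeff_sep_poly_sign: "0 < (-1) ^ (sep_degree + sep_offset) * lead_coeff sep_poly"
proof -
  have const: "0 < lead_const" by (rule lead_const_pos[OF prod_inverse_pos])
  have "degree sep_poly \<le> sep_degree \<and> 0 < (-1) ^ (sep_degree + sep_offset) * coeff sep_poly sep_degree"
  proof (cases "f 0 * M$2$2 = M$2$1")
    case True
    then have "M$2$2 * (M$1$1 - f 0 * M$1$2) = 1"
      using det_M by (simp add: det_2 algebra_simps)
    then have "0 < M$2$2" using lead_pos by (metis zero_less_mult_pos2 zero_less_one)
    then have "0 < lead_const * ((f 0)\<^sup>2 / w 1 * M$2$2)"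
      using const w_pos f_0_1_nonzero N_ge_2 by simp
    then show ?thesis
      using True degree_quasi_exceptional_le[of "M$2$2" "- M$2$1"]
        coeff_quasi_exceptional[of "M$2$2" "- M$2$1"] N_ge_2
      by (simp add: sep_poly_def sep_degree_def sep_offset_def flip: mult.assoc power_add)
  next
    case False
    then show ?thesis
      using const degree_quasi_le[of "M$2$2" "- M$2$1"]
      by (auto simp: sep_poly_def sep_degree_def sep_offset_def coeff_quasi
          zero_less_mult_iff mult_less_0_iff simp flip: mult.assoc power_add)
  qed
  moreover from this show "degree sep_poly = sep_degree" by (intro antisym le_degree) auto
  ultimately show "0 < (-1) ^ (sep_degree + sep_offset) * lead_coeff sep_poly" by simp
qed

lemma sl_eig_bc_V_strict_mono: "strict_mono_on {..<sep_degree} (sl_eig f q w N (bc_V M))"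
  and sep_poly_at_sl_eig_bc_V:
    "j < sep_degree \<Longrightarrow> poly sep_poly (sl_eig f q w N (bc_V M) j) = 0"
  and pderiv_sep_poly_at_sl_eig_bc_V:
    "j < sep_degree \<Longrightarrow> 0 < (-1) ^ (sep_degree - Suc j) * lead_coeff sep_poly *
       poly (pderiv sep_poly) (sl_eig f q w N (bc_V M) j)"
proof -
  have nonzero: "sep_poly \<noteq> 0" using lead_coeff_sep_poly_sign by auto
  have "card {x. poly sep_poly x = 0} = degree sep_poly"
    using card_roots_quasi[OF row_2_nonzero] unfolding sep_poly_def .
  then obtain \<nu> where mono: "strict_mono_on {..<sep_degree} \<nu>"
    and roots: "\<nu> ` {..<sep_degree} = {x. poly sep_poly x = 0}"
    and sign: "\<And>j. j < sep_degree \<Longrightarrow>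
      0 < (-1) ^ (sep_degree - Suc j) * lead_coeff sep_poly * poly (pderiv sep_poly) (\<nu> j)"
    using simple_real_roots_enum[OF nonzero] unfolding degree_sep_poly by metis
  have eig: "sl_eig f q w N (bc_V M) j = \<nu> j" if "j < sep_degree" for j
  proof (rule sl_eig_eqI[OF f_nonzero strict_mono_on_imp_mono_on[OF mono] _ that])
    fix x
    show "sl_mult f q w N (bc_V M) (of_real x) = count (image_mset \<nu> (mset_set {..<sep_degree})) x"
      unfolding image_mset_mset_set[OF strict_mono_on_imp_inj_on[OF mono]] roots sl_mult_bc_V
      using poly_roots_finite[OF nonzero] by (simp add: count_mset_set')
  qed
  then show "strict_mono_on {..<sep_degree} (sl_eig f q w N (bc_V M))"
    using strict_mono_onD[OF mono] by (intro strict_mono_onI) simp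
  assume j: "j < sep_degree"
  show "poly sep_poly (sl_eig f q w N (bc_V M) j) = 0" using eig[OF j] roots j by auto
  show "0 < (-1) ^ (sep_degree - Suc j) * lead_coeff sep_poly *
      poly (pderiv sep_poly) (sl_eig f q w N (bc_V M) j)"
    using sign[OF j] eig[OF j] by simp
qed

lemma discr_at_sl_eig_bc_V:
  assumes j: "j < sep_degree"
  shows "2 \<le> (-1) ^ (j + sep_offset) * poly discr (sl_eig f q w N (bc_V M) j)"
proof -
  define D where "D = poly discr (sl_eig f q w N (bc_V M) j)"
  define g' where "g' = poly (pderiv sep_poly) (sl_eig f q w N (bc_V M) j)"
  have D: "D * g' < 0" "2 \<le> \<bar>D\<bar>"
    using discr_at_sep_root[OF sep_poly_at_sl_eig_bc_V[OF j]] by (simp_all add: D_def g'_def)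
  have "(-1::real) ^ (sep_degree - Suc j) =
      - ((-1) ^ (sep_degree + sep_offset) * (-1) ^ (j + sep_offset))"
    using j by (auto simp: minus_one_power_iff)
  then have "0 < ((-1) ^ (sep_degree + sep_offset) * lead_coeff sep_poly) *
      - ((-1) ^ (j + sep_offset) * g')"
    using pderiv_sep_poly_at_sl_eig_bc_V[OF j] by (simp add: g'_def mult_ac)
  then have "0 < - ((-1) ^ (j + sep_offset) * g')"
    by (rule zero_less_mult_pos[OF _ lead_coeff_sep_poly_sign])
  then have "2 \<le> (-1) ^ (j + sep_offset) * D"
    using D by (cases "even (j + sep_offset)") (auto simp: mult_less_0_iff)
  then show ?thesis by (simp add: D_def)
qed

lemma separated_bands:
  obtains \<alpha> \<beta> where "poly_bands discr 2 N \<alpha> \<beta>"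
    "\<And>j. j < sep_degree \<Longrightarrow> j + sep_offset < N \<Longrightarrow> sl_eig f q w N (bc_V M) j \<le> \<alpha> (j + sep_offset)"
    "\<And>i j. j < sep_degree \<Longrightarrow> j + sep_offset = Suc i \<Longrightarrow> \<beta> i \<le> sl_eig f q w N (bc_V M) j"
proof -
  have range: "sep_offset \<le> 1" "N \<le> sep_degree + sep_offset" "sep_degree + sep_offset \<le> Suc N"
    using N_ge_2 by (auto simp: sep_degree_def sep_offset_def)
  obtain t where t: "strict_mono_on {..N} t" "\<And>j. j \<le> N \<Longrightarrow> 2 \<le> (-1) ^ j * poly discr (t j)"
    and t_eig: "\<And>j. j < sep_degree \<Longrightarrow> t (j + sep_offset) = sl_eig f q w N (bc_V M) j"
    using alternating_points_extend[OF degree_discr _ lead_coeff_discr_sign sl_eig_bc_V_strict_mono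
        discr_at_sl_eig_bc_V range] N_ge_2 by auto
  obtain \<alpha> \<beta> where bands: "poly_bands discr 2 N \<alpha> \<beta>"
    "\<And>j. j < N \<Longrightarrow> t j \<le> \<alpha> j" "\<And>j. j < N \<Longrightarrow> \<beta> j \<le> t (Suc j)"
    using poly_bands_exist[OF _ t] by auto
  show ?thesis
  proof (rule that[OF bands(1)])
    fix i j assume "j < sep_degree" "j + sep_offset = Suc i"
    then show "\<beta> i \<le> sl_eig f q w N (bc_V M) j"
      using bands(3)[of i] t_eig[of j] range by simp
  qed (use bands(2) t_eig in metis)
qed

lemma coupled_interlacing:
  assumes \<gamma>: "- pi < \<gamma>" "\<gamma> < pi" "\<gamma> \<noteq> 0"
  defines "lM \<equiv> sl_eig f q w N (bc_coupled (cmat M))"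
    and "lnM \<equiv> sl_eig f q w N (bc_coupled (cmat (- M)))"
    and "lg \<equiv> sl_eig f q w N (floquet_bc \<gamma>)"
    and "lV \<equiv> sl_eig f q w N (bc_V M)"
  shows "\<forall>j<N. (even j \<longrightarrow> lM j < lg j \<and> lg j < lnM j) \<and> (odd j \<longrightarrow> lnM j < lg j \<and> lg j < lM j)"
    and "j < sep_degree \<Longrightarrow> j + sep_offset < N \<Longrightarrow>
      lV j \<le> min (lM (j + sep_offset)) (lnM (j + sep_offset))"
    and "j < sep_degree \<Longrightarrow> j + sep_offset = Suc i \<Longrightarrow> max (lM i) (lnM i) \<le> lV j"
proof -
  obtain \<alpha> \<beta> where bands: "poly_bands discr 2 N \<alpha> \<beta>"
    and sep: "\<And>j. j < sep_degree \<Longrightarrow> j + sep_offset < N \<Longrightarrow> lV j \<le> \<alpha> (j + sep_offset)"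
      "\<And>i j. j < sep_degree \<Longrightarrow> j + sep_offset = Suc i \<Longrightarrow> \<beta> i \<le> lV j"
    using separated_bands unfolding lV_def by blast
  have ends: "lM j = (if even j then \<alpha> j else \<beta> j)" "lnM j = (if even j then \<beta> j else \<alpha> j)"
    and inside: "\<alpha> j < lg j \<and> lg j < \<beta> j" if "j < N" for j
    unfolding lM_def lnM_def lg_def
    using sl_eig_coupled[OF bands degree_discr that]
      sl_eig_floquet_bc_strictly_inside[OF bands degree_discr \<gamma> that] by blast+
  have min_max: "min (lM j) (lnM j) = \<alpha> j" "max (lM j) (lnM j) = \<beta> j" if "j < N" for j
    using ends[OF that] inside[OF that] by auto
  show "\<forall>j<N. (even j \<longrightarrow> lM j < lg j \<and> lg j < lnM j) \<and> (odd j \<longrightarrow> lnM j < lg j \<and> lg j < lM j)"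
    using ends inside by simp
  show "lV j \<le> min (lM (j + sep_offset)) (lnM (j + sep_offset))"
    if "j < sep_degree" "j + sep_offset < N"
    using sep(1)[OF that] min_max(1)[OF that(2)] by simp
  show "max (lM i) (lnM i) \<le> lV j" if "j < sep_degree" "j + sep_offset = Suc i"
  proof -
    have "i < N" using that N_ge_2 by (auto simp: sep_degree_def sep_offset_def split: if_splits)
    then show ?thesis using sep(2)[OF that] min_max(2) by simp
  qed
qed

end

end

theorem theorem3p11:
  fixes N :: nat and f q w :: "nat \<Rightarrow> real" and \<gamma> :: real and K :: "real^2^2"
  assumes N2: "N \<ge> 2"
    and f_nz: "\<forall>n\<le>N. f n \<noteq> 0"
    and w_pos: "\<forall>n\<in>{1..N}. w n > 0"
    and prod_pos: "(\<Prod>i=0..N-1. 1 / f i) > 0"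
    and gamma: "-pi < \<gamma>" "\<gamma> < pi" "\<gamma> \<noteq> 0"
    and SL: "det K = 1"
    and K_cond: "K$1$1 - f 0 * K$1$2 \<noteq> 0"
  shows "\<forall>M \<in> {K, -K}.
    (let lam = (\<lambda>A j. sl_eig f q w N (bc_coupled A) j);
         lM = lam (cmat M); lnM = lam (cmat (-M));
         lg = lam (\<chi> i j. exp (\<i> * complex_of_real \<gamma>) * cmat M $ i $ j);
         lV = (\<lambda>j. sl_eig f q w N (bc_V K) j);
         mn = (\<lambda>j. min (lM j) (lnM j)); mx = (\<lambda>j. max (lM j) (lnM j));
         P = (\<forall>j<N. (even j \<longrightarrow> lM j < lg j \<and> lg j < lnM j) \<and>
                     (odd j \<longrightarrow> lnM j < lg j \<and> lg j < lM j))
     in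
     (M$1$1 - f 0 * M$1$2 > 0 \<and> f 0 * M$2$2 - M$2$1 > 0 \<longrightarrow>
        P \<and> (\<forall>j<N. lV j \<le> mn j) \<and> (\<forall>j. j + 1 < N \<longrightarrow> mx j \<le> lV (j+1)))
   \<and> (M$1$1 - f 0 * M$1$2 > 0 \<and> f 0 * M$2$2 - M$2$1 < 0 \<longrightarrow>
        P \<and> (\<forall>j. j + 1 < N \<longrightarrow> mx j \<le> lV j \<and> lV j \<le> mn (j+1)) \<and> mx (N-1) \<le> lV (N-1))
   \<and> (M$1$1 - f 0 * M$1$2 > 0 \<and> f 0 * M$2$2 - M$2$1 = 0 \<longrightarrow>
        P \<and> (\<forall>j. j + 1 < N \<longrightarrow> mx j \<le> lV j \<and> lV j \<le> mn (j+1))))"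
    (is "\<forall>M \<in> _. ?claim M")
proof
  fix M assume M: "M \<in> {K, - K}"
  then have bc_V: "sl_eig f q w N (bc_V M) = sl_eig f q w N (bc_V K)"
    using sl_eig_bc_V_uminus by auto
  have "det M = 1" using SL M by (auto simp: det_2)
  then interpret sl_coupled N f q w M
    using N2 f_nz w_pos by unfold_locales auto
  note interlacing = coupled_interlacing[OF prod_pos _ gamma, unfolded floquet_bc_def bc_V]
  show "?claim M"
    unfolding Let_def
  proof (intro conjI[of "_ \<longrightarrow> _"] impI, goal_cases)
    case 1
    then have "sep_degree = N" "sep_offset = 0" by (simp_all add: sep_degree_def sep_offset_def)
    then show ?case using 1 interlacing by simp
  next
    case 2
    then have "sep_degree = N" "sep_offset = 1" by (simp_all add: sep_degree_def sep_offset_def)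
    then show ?case using 2 interlacing N2 by simp
  next
    case 3
    then have "sep_degree = N - 1" "sep_offset = 1" by (simp_all add: sep_degree_def sep_offset_def)
    then show ?case using 3 interlacing by simp
  qed
qed

end
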